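(* Let $M$ be a pointed metric space with at least two points. The following statements are equivalent: (i) $\mathrm{Lip}_0(M)$, regarded as the dual space of $\mathcal{F}(M)$, has the weak$^*$ symmetric strong diameter $2$ property ($w^*$-SSD$2$P); (ii) the Lipschitz-free space $\mathcal{F}(M)$ is decomposably octahedral (DOH); (iii) $M$ has the strong long trapezoid property (SLTP).
   Context: All Banach spaces are real and nontrivial ($\neq\{0\}$). For a Banach space $X$, $B_X$, $S_X$ and $X^*$ denote its closed unit ball, unit sphere and (topological) dual space. A pointed metric space is a metric space $(M,d)$ with a fixed point $0\in M$. $\mathrm{Lip}_0(M)$ is the Banach space of all Lipschitz functions $f\colon M\to\mathbb{R}$ with $f(0)=0$, with norm $\|f\|_{\mathrm{Lip}}=\sup\{|f(x)-f(y)|/d(x,y): x,y\in M,\ x\neq y\}$. For $x\in M$ let $\delta_x\colon M\to\mathbb{R}$ be the characteristic function of $\{x\}$. The Lipschitz-free space $\mathcal{F}(M)$ is the completion of $\mathcal{M}(M)=\mathrm{span}\{\delta_p-\delta_q: p,q\in M\}$ with respect to the Arens--Eells norm $$\|\mu\|=\inf\Bigl\{\sum_{i=1}^n|\lambda_i|d(p_i,q_i): \mu=\sum_{i=1}^n\lambda_i(\delta_{p_i}-\delta_{q_i}),\ \lambda_i\in\mathbb{R},\ p_i,q_i\in M,\ n\in\mathbb{N}\Bigr\}.$$ The dual $\mathcal{F}(M)^*$ is isometrically isomorphic to $\mathrm{Lip}_0(M)$ via the pairing determined by $(f,\mu)\mapsto\sum_{p\in M}f(p)\mu(p)$ for $f\in\mathrm{Lip}_0(M)$,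 $\mu\in\mathcal{M}(M)$; weak$^*$ notions in $\mathrm{Lip}_0(M)$ refer to this identification. A weak$^*$ slice of $B_{X^*}$ is a set of the form $S(B_{X^*},x,\alpha)=\{x^*\in B_{X^*}: x^*(x)>1-\alpha\}$ with $x\in S_X$ and $\alpha>0$. The dual space $X^*$ has the weak$^*$ symmetric strong diameter $2$ property ($w^*$-SSD$2$P) if, for every finite family $\{S_i\}_{i=1}^n$ of weak$^*$ slices of $B_{X^*}$ and every $\varepsilon>0$, there exist $f_i\in S_i$, $i=1,\ldots,n$, and $g\in B_{X^*}$ such that $f_i+g\in S_i$ and $f_i-g\in S_i$ for every $i\in\{1,\ldots,n\}$, and $\|g\|>1-\varepsilon$. A Banach space $X$ is decomposably octahedral (DOH) if, for every finite subset $E$ of $S_X$ and every $\varepsilon>0$, there exists $y\in S_X$ such that, for every $n\in\mathbb{N}$, all $y_1,\ldots,y_n\in X$ with $\sum_{i=1}^n y_i=y$, all $x_1,\ldots,x_n\in E$ (not necessarily distinct), and all real $a_1,b_1,\ldots,a_n,b_n\geq 0$, $$\sum_{i=1}^n\bigl(\|a_ix_i+y_i\|+\|b_ix_i-y_i\|\bigr)\geq(1-\varepsilon)\Bigl(\sum_{i=1}^n(a_i+b_i)+2\Bigr).$$ A metric space $M$ has the strong long trapezoid property (SLTP) if, for every finite subset $N$ of $M$ and every $\varepsilon>0$, there exist $u,v\in M$, $u\neq v$, such that, for any $x,y\in N$, $$(1-\varepsilon)\bigl(d(x,y)+d(u,v)\bigr)\leq d(x,u)+d(y,v),$$ and, for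 any $x,y,z,w\in N$, $$(1-\varepsilon)\bigl(d(x,y)+d(z,w)+2d(u,v)\bigr)\leq d(x,u)+d(y,u)+d(z,v)+d(w,v).$$ *)

theory Defs
  imports "HOL-Analysis.Analysis"
begin

section \<open>Completion of a real normed space\<close>

definition cauchy_rel :: "(nat \<Rightarrow> 'x::real_normed_vector) \<Rightarrow> (nat \<Rightarrow> 'x) \<Rightarrow> bool" where
  "cauchy_rel X Y \<longleftrightarrow> Cauchy X \<and> Cauchy Y \<and> (\<lambda>n. X n - Y n) \<longlonglongrightarrow> 0"

lemma cauchy_rel_refl [simp]: "cauchy_rel X X \<longleftrightarrow> Cauchy X"
  by (simp add: cauchy_rel_def)

lemma cauchy_rel_part_equivp: "part_equivp (cauchy_rel :: (nat \<Rightarrow> 'x::real_normed_vector) \<Rightarrow> _)"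
proof (rule part_equivpI)
  show "\<exists>X::nat \<Rightarrow> 'x. cauchy_rel X X"
    by (rule exI[of _ "\<lambda>_. 0"]) (simp add: Cauchy_def)
  show "symp (cauchy_rel :: (nat \<Rightarrow> 'x) \<Rightarrow> _)"
  proof (rule sympI)
    fix X Y :: "nat \<Rightarrow> 'x" assume "cauchy_rel X Y"
    then show "cauchy_rel Y X"
      using tendsto_minus[of "\<lambda>n. X n - Y n" 0 sequentially] by (simp add: cauchy_rel_def)
  qed
  show "transp (cauchy_rel :: (nat \<Rightarrow> 'x) \<Rightarrow> _)"
  proof (rule transpI)
    fix X Y Z :: "nat \<Rightarrow> 'x" assume "cauchy_rel X Y" "cauchy_rel Y Z"
    then show "cauchy_rel X Z"
      using tendsto_add[of "\<lambda>n. X n - Y n" 0 sequentially "\<lambda>n. Y n - Z n" 0]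
      by (simp add: cauchy_rel_def)
  qed
qed

quotient_type (overloaded) 'x completion =
    "nat \<Rightarrow> 'x::real_normed_vector" / partial: cauchy_rel
  by (rule cauchy_rel_part_equivp)

lemma Cauchy_add_seq:
  fixes X Y :: "nat \<Rightarrow> 'x::real_normed_vector"
  assumes "Cauchy X" "Cauchy Y" shows "Cauchy (\<lambda>n. X n + Y n)"
proof (rule metric_CauchyI)
  fix e :: real assume "e > 0"
  then obtain M N where M: "\<And>m n. m \<ge> M \<Longrightarrow> n \<ge> M \<Longrightarrow> dist (X m) (X n) < e/2"
    and N: "\<And>m n. m \<ge> N \<Longrightarrow> n \<ge> N \<Longrightarrow> dist (Y m) (Y n) < e/2"
    using assms unfolding Cauchy_def by (metis half_gt_zero)
  show "\<exists>M. \<forall>m\<ge>M. \<forall>n\<ge>M. dist (X m + Y m) (X n + Y n) < e"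
  proof (intro exI allI impI)
    fix m n assume "m \<ge> max M N" "n \<ge> max M N"
    then show "dist (X m + Y m) (X n + Y n) < e"
      using M[of m n] N[of m n] dist_triangle_add[of "X m" "Y m" "X n" "Y n"] by simp
  qed
qed

lemma Cauchy_bounded_linear_seq:
  assumes "bounded_linear f" "Cauchy X" shows "Cauchy (\<lambda>n. f (X n))"
  using bounded_linear.Cauchy[OF assms] .

lemma Cauchy_uminus_seq: "Cauchy X \<Longrightarrow> Cauchy (\<lambda>n. - X n :: 'x::real_normed_vector)"
  by (rule Cauchy_bounded_linear_seq[OF bounded_linear_minus[OF bounded_linear_ident]])

lemma Cauchy_scaleR_seq: "Cauchy X \<Longrightarrow> Cauchy (\<lambda>n. c *\<^sub>R X n :: 'x::real_normed_vector)"
  by (rule Cauchy_bounded_linear_seq[OF bounded_linear_scaleR_right])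

lemma Cauchy_diff_seq:
  fixes X Y :: "nat \<Rightarrow> 'x::real_normed_vector"
  shows "Cauchy X \<Longrightarrow> Cauchy Y \<Longrightarrow> Cauchy (\<lambda>n. X n - Y n)"
  using Cauchy_add_seq[of X "\<lambda>n. - Y n"] Cauchy_uminus_seq[of Y] by simp

lemma Cauchy_norm_convergent:
  fixes X :: "nat \<Rightarrow> 'x::real_normed_vector"
  assumes "Cauchy X" shows "convergent (\<lambda>n. norm (X n))"
proof -
  have "Cauchy (\<lambda>n. norm (X n))"
  proof (rule metric_CauchyI)
    fix e :: real assume "e > 0"
    then obtain M where "\<forall>m\<ge>M. \<forall>n\<ge>M. dist (X m) (X n) < e"
      using assms unfolding Cauchy_def by blast
    moreover have "dist (norm (X m)) (norm (X n)) \<le> dist (X m) (X n)" for m n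
      by (simp add: dist_norm norm_triangle_ineq3)
    ultimately show "\<exists>M. \<forall>m\<ge>M. \<forall>n\<ge>M. dist (norm (X m)) (norm (X n)) < e"
      by (meson le_less_trans)
  qed
  then show ?thesis by (rule real_Cauchy_convergent)
qed

lemma cauchy_rel_norm_lim:
  fixes X Y :: "nat \<Rightarrow> 'x::real_normed_vector"
  assumes "cauchy_rel X Y" shows "lim (\<lambda>n. norm (X n)) = lim (\<lambda>n. norm (Y n))"
proof -
  have "(\<lambda>n. norm (Y n)) \<longlonglongrightarrow> lim (\<lambda>n. norm (Y n))"
    using assms Cauchy_norm_convergent[of Y] by (simp add: cauchy_rel_def convergent_LIMSEQ_iff)
  moreover have "(\<lambda>n. norm (X n) - norm (Y n)) \<longlonglongrightarrow> 0"
  proof (rule Lim_null_comparison[OF always_eventually])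
    show "\<forall>n. norm (norm (X n) - norm (Y n)) \<le> norm (X n - Y n)"
      by (simp add: norm_triangle_ineq3)
    show "(\<lambda>n. norm (X n - Y n)) \<longlonglongrightarrow> 0"
      using assms by (simp add: cauchy_rel_def tendsto_norm_zero)
  qed
  ultimately have "(\<lambda>n. (norm (X n) - norm (Y n)) + norm (Y n)) \<longlonglongrightarrow> 0 + lim (\<lambda>n. norm (Y n))"
    by (intro tendsto_add)
  then show ?thesis by (simp add: limI)
qed

instantiation completion :: (real_normed_vector) real_normed_vector
begin

lift_definition zero_completion :: "'a completion" is "\<lambda>_. 0"
  by (simp add: Cauchy_def)

lift_definition plus_completion :: "'a completion \<Rightarrow> 'a completion \<Rightarrow> 'a completion"
  is "\<lambda>X Y n. X n + Y n"
  unfolding cauchy_rel_def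
proof (elim conjE, intro conjI)
  fix X X' Y Y' :: "nat \<Rightarrow> 'a"
  assume "(\<lambda>n. X n - X' n) \<longlonglongrightarrow> 0" "(\<lambda>n. Y n - Y' n) \<longlonglongrightarrow> 0"
  from tendsto_add[OF this] show "(\<lambda>n. X n + Y n - (X' n + Y' n)) \<longlonglongrightarrow> 0"
    by (simp add: algebra_simps)
qed (auto intro: Cauchy_add_seq)

lift_definition uminus_completion :: "'a completion \<Rightarrow> 'a completion"
  is "\<lambda>X n. - X n"
  unfolding cauchy_rel_def
proof (elim conjE, intro conjI)
  fix X X' :: "nat \<Rightarrow> 'a"
  assume "(\<lambda>n. X n - X' n) \<longlonglongrightarrow> 0"
  from tendsto_minus[OF this] show "(\<lambda>n. - X n - - X' n) \<longlonglongrightarrow> 0" by simp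
qed (auto intro: Cauchy_uminus_seq)

definition minus_completion :: "'a completion \<Rightarrow> 'a completion \<Rightarrow> 'a completion" where
  "minus_completion x y = x + - y"

lift_definition scaleR_completion :: "real \<Rightarrow> 'a completion \<Rightarrow> 'a completion"
  is "\<lambda>c X n. c *\<^sub>R X n"
  unfolding cauchy_rel_def
proof (elim conjE, intro conjI)
  fix c and X X' :: "nat \<Rightarrow> 'a"
  assume "(\<lambda>n. X n - X' n) \<longlonglongrightarrow> 0"
  from tendsto_scaleR[OF tendsto_const[of c] this]
  show "(\<lambda>n. c *\<^sub>R X n - c *\<^sub>R X' n) \<longlonglongrightarrow> 0" by (simp add: scaleR_diff_right)
qed (auto intro: Cauchy_scaleR_seq)

lift_definition norm_completion :: "'a completion \<Rightarrow> real" is "\<lambda>X. lim (\<lambda>n. norm (X n))"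
  by (rule cauchy_rel_norm_lim)

definition dist_completion :: "'a completion \<Rightarrow> 'a completion \<Rightarrow> real" where
  "dist_completion x y = norm (x - y)"

definition sgn_completion :: "'a completion \<Rightarrow> 'a completion" where
  "sgn_completion x = inverse (norm x) *\<^sub>R x"

definition uniformity_completion :: "('a completion \<times> 'a completion) filter" where
  "uniformity_completion = (INF e\<in>{0 <..}. principal {(x, y). dist x y < e})"

definition open_completion :: "'a completion set \<Rightarrow> bool" where
  "open_completion U = (\<forall>x\<in>U. eventually (\<lambda>(x', y). x' = x \<longrightarrow> y \<in> U) uniformity)"

instance
proof
  fix x y z :: "'a completion" and a b :: real
  show "x + y + z = x + (y + z)"
    by (transfer, auto simp: add.assoc intro!: Cauchy_add_seq)
  show "x + y = y + x"
    by (transfer, auto simp: add.commute intro!: Cauchy_add_seq)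
  show "0 + x = x" by transfer auto
  show "- x + x = 0" by (transfer, auto simp: Cauchy_def)
  show "x - y = x + - y" by (fact minus_completion_def)
  show "a *\<^sub>R (x + y) = a *\<^sub>R x + a *\<^sub>R y"
    by (transfer, auto simp: scaleR_add_right intro!: Cauchy_add_seq Cauchy_scaleR_seq)
  show "(a + b) *\<^sub>R x = a *\<^sub>R x + b *\<^sub>R x"
    by (transfer, auto simp: scaleR_add_left intro!: Cauchy_add_seq Cauchy_scaleR_seq)
  show "a *\<^sub>R b *\<^sub>R x = (a * b) *\<^sub>R x"
    by (transfer, auto intro!: Cauchy_scaleR_seq)
  show "1 *\<^sub>R x = x" by transfer auto
  show "dist x y = norm (x - y)" by (fact dist_completion_def)
  show "sgn x = inverse (norm x) *\<^sub>R x" by (fact sgn_completion_def)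
  show "uniformity = (INF e\<in>{0 <..}. principal {(x, y :: 'a completion). dist x y < e})"
    by (fact uniformity_completion_def)
  show "open U = (\<forall>x\<in>U. eventually (\<lambda>(x', y). x' = x \<longrightarrow> y \<in> U) uniformity)"
    for U :: "'a completion set" by (fact open_completion_def)
  show "norm x = 0 \<longleftrightarrow> x = 0"
  proof transfer
    fix X :: "nat \<Rightarrow> 'a" assume X: "cauchy_rel X X"
    then have lim: "(\<lambda>n. norm (X n)) \<longlonglongrightarrow> lim (\<lambda>n. norm (X n))"
      using Cauchy_norm_convergent[of X] by (simp add: convergent_LIMSEQ_iff)
    show "(lim (\<lambda>n. norm (X n)) = 0) = cauchy_rel X (\<lambda>_. 0)"
    proof
      assume "lim (\<lambda>n. norm (X n)) = 0"
      with lim have "X \<longlonglongrightarrow> 0" by (simp add: tendsto_norm_zero_cancel)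
      with X show "cauchy_rel X (\<lambda>_. 0)" by (simp add: cauchy_rel_def Cauchy_def)
    next
      assume "cauchy_rel X (\<lambda>_. 0)"
      then show "lim (\<lambda>n. norm (X n)) = 0"
        by (simp add: cauchy_rel_def limI tendsto_norm_zero)
    qed
  qed
  show "norm (x + y) \<le> norm x + norm y"
  proof transfer
    fix X Y :: "nat \<Rightarrow> 'a" assume "cauchy_rel X X" "cauchy_rel Y Y"
    then have "(\<lambda>n. norm (X n)) \<longlonglongrightarrow> lim (\<lambda>n. norm (X n))"
      "(\<lambda>n. norm (Y n)) \<longlonglongrightarrow> lim (\<lambda>n. norm (Y n))"
      "(\<lambda>n. norm (X n + Y n)) \<longlonglongrightarrow> lim (\<lambda>n. norm (X n + Y n))"
      using Cauchy_norm_convergent[of X] Cauchy_norm_convergent[of Y]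
        Cauchy_norm_convergent[OF Cauchy_add_seq[of X Y]]
      by (simp_all add: convergent_LIMSEQ_iff)
    then show "lim (\<lambda>n. norm (X n + Y n)) \<le> lim (\<lambda>n. norm (X n)) + lim (\<lambda>n. norm (Y n))"
      by (intro LIMSEQ_le[OF _ tendsto_add]) (auto intro: norm_triangle_ineq)
  qed
  show "norm (a *\<^sub>R x) = \<bar>a\<bar> * norm x"
  proof transfer
    fix a :: real and X :: "nat \<Rightarrow> 'a" assume "cauchy_rel X X"
    then have "(\<lambda>n. norm (X n)) \<longlonglongrightarrow> lim (\<lambda>n. norm (X n))"
      using Cauchy_norm_convergent[of X] by (simp add: convergent_LIMSEQ_iff)
    then have "(\<lambda>n. \<bar>a\<bar> * norm (X n)) \<longlonglongrightarrow> \<bar>a\<bar> * lim (\<lambda>n. norm (X n))"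
      by (intro tendsto_mult tendsto_const)
    then show "lim (\<lambda>n. norm (a *\<^sub>R X n)) = \<bar>a\<bar> * lim (\<lambda>n. norm (X n))"
      by (simp add: limI)
  qed
qed

end

lift_definition completion_embed :: "'x::real_normed_vector \<Rightarrow> 'x completion" is "\<lambda>x _. x"
  by (simp add: Cauchy_def)

lemma completion_embed_add: "completion_embed (x + y) = completion_embed x + completion_embed y"
  by transfer (simp add: Cauchy_def)

lemma completion_embed_scaleR: "completion_embed (c *\<^sub>R x) = c *\<^sub>R completion_embed x"
  by transfer (simp add: Cauchy_def)

lemma linear_completion_embed: "linear completion_embed"
  by (rule linearI) (simp_all add: completion_embed_add completion_embed_scaleR)

lemma norm_completion_embed [simp]: "norm (completion_embed x) = norm x"
  by transfer simp

lemma bounded_linear_completion_embed: "bounded_linear completion_embed"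
  by (rule bounded_linear_intro[where K = 1])
    (simp_all add: completion_embed_add completion_embed_scaleR)

lemma abs_completion_diff_embed:
  assumes "Cauchy X"
  shows "abs_completion X - completion_embed y = abs_completion (\<lambda>n. X n - y)"
proof -
  have y: "Cauchy (\<lambda>_. y)" by (simp add: Cauchy_def)
  have "- completion_embed y = abs_completion (\<lambda>_. - y)"
    unfolding completion_embed.abs_eq using y by (simp add: uminus_completion.abs_eq)
  moreover have "Cauchy (\<lambda>_. - y)" by (simp add: Cauchy_def)
  ultimately show ?thesis
    using assms by (simp add: minus_completion_def plus_completion.abs_eq)
qed

lemma completion_embed_tendsto_abs:
  assumes X: "Cauchy X"
  shows "(\<lambda>n. completion_embed (X n)) \<longlonglongrightarrow> abs_completion X"
proof (rule metric_LIMSEQ_I)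
  fix e :: real assume "e > 0"
  then obtain N where N: "\<And>m n. m \<ge> N \<Longrightarrow> n \<ge> N \<Longrightarrow> dist (X m) (X n) < e/2"
    using X unfolding Cauchy_def by (metis half_gt_zero)
  have "dist (completion_embed (X m)) (abs_completion X) < e" if "m \<ge> N" for m
  proof -
    have c: "Cauchy (\<lambda>n. X n - X m)"
      using X by (intro Cauchy_diff_seq) (auto simp: Cauchy_def)
    have "norm (abs_completion (\<lambda>n. X n - X m)) = lim (\<lambda>n. norm (X n - X m))"
      using c by (simp add: norm_completion.abs_eq)
    moreover have "(\<lambda>n. norm (X n - X m)) \<longlonglongrightarrow> lim (\<lambda>n. norm (X n - X m))"
      using Cauchy_norm_convergent[OF c] by (simp add: convergent_LIMSEQ_iff)
    moreover have "\<exists>N. \<forall>n\<ge>N. norm (X n - X m) \<le> e/2"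
      using N that by (intro exI[of _ N]) (auto simp: dist_norm intro: less_imp_le)
    ultimately have "norm (abs_completion (\<lambda>n. X n - X m)) \<le> e/2"
      by (metis LIMSEQ_le_const2)
    then show ?thesis
      using \<open>e > 0\<close> abs_completion_diff_embed[OF X, of "X m"]
      by (simp add: dist_norm norm_minus_commute[of "completion_embed (X m)"])
  qed
  then show "\<exists>N. \<forall>n\<ge>N. dist (completion_embed (X n)) (abs_completion X) < e" by blast
qed

lemma completion_sequence:
  fixes z :: "'x::real_normed_vector completion"
  obtains X where "Cauchy X" "(\<lambda>n. completion_embed (X n)) \<longlonglongrightarrow> z"
proof (rule that)
  have "cauchy_rel (rep_completion z) (rep_completion z)"
    using Quotient3_rep_reflp[OF Quotient3_completion] .
  then show c: "Cauchy (rep_completion z)" by simp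
  show "(\<lambda>n. completion_embed (rep_completion z n)) \<longlonglongrightarrow> z"
    using completion_embed_tendsto_abs[OF c] by (simp add: Quotient3_abs_rep[OF Quotient3_completion])
qed

lemma closure_range_completion_embed:
  "closure (range (completion_embed :: 'x::real_normed_vector \<Rightarrow> _)) = UNIV"
proof -
  have "z \<in> closure (range (completion_embed :: 'x \<Rightarrow> _))" for z :: "'x completion"
    using completion_sequence[of z] unfolding closure_sequential by (metis rangeI)
  then show ?thesis by blast
qed

instance completion :: (real_normed_vector) banach
proof
  fix F :: "nat \<Rightarrow> 'a completion" assume F: "Cauchy F"
  have "\<exists>x. dist (F n) (completion_embed x) < 1 / Suc n" for n
  proof -
    have "F n \<in> closure (range completion_embed)" by (simp add: closure_range_completion_embed)
    then show ?thesis
      unfolding closure_approachable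
      by (metis dist_commute image_iff of_nat_0_less_iff zero_less_Suc zero_less_divide_1_iff)
  qed
  then obtain x where x: "\<And>n. dist (F n) (completion_embed (x n)) < 1 / Suc n" by metis
  have null: "(\<lambda>n. F n - completion_embed (x n)) \<longlonglongrightarrow> 0"
  proof (rule Lim_null_comparison[OF always_eventually])
    show "\<forall>n. norm (F n - completion_embed (x n)) \<le> 1 / real (Suc n)"
      using x by (simp add: dist_norm less_imp_le)
    show "(\<lambda>n. 1 / real (Suc n)) \<longlonglongrightarrow> 0"
      using LIMSEQ_inverse_real_of_nat by (simp add: inverse_eq_divide)
  qed
  have "Cauchy (\<lambda>n. F n - (F n - completion_embed (x n)))"
    by (intro Cauchy_diff_seq F LIMSEQ_imp_Cauchy[OF null])
  then have "Cauchy (\<lambda>n. completion_embed (x n))" by simp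
  moreover have "dist (completion_embed (x m)) (completion_embed (x n)) = dist (x m) (x n)" for m n
    by (simp add: dist_norm linear_diff[OF linear_completion_embed, symmetric])
  ultimately have "Cauchy x" by (simp add: Cauchy_def)
  from tendsto_add[OF null completion_embed_tendsto_abs[OF this]]
  have "F \<longlonglongrightarrow> abs_completion x" by simp
  then show "convergent F" by (rule convergentI)
qed

lemma completion_extension:
  fixes g :: "'x::real_normed_vector \<Rightarrow> 'y::banach"
  assumes "bounded_linear g"
  shows "\<exists>!\<phi> :: 'x completion \<Rightarrow>\<^sub>L 'y. \<forall>x. blinfun_apply \<phi> (completion_embed x) = g x"
proof (rule ex_ex1I)
  interpret g: bounded_linear g by fact
  define h where "h z = lim (\<lambda>n. g (rep_completion z n))" for z
  have h: "(\<lambda>n. g (X n)) \<longlonglongrightarrow> h z"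
    if X: "Cauchy X" "(\<lambda>n. completion_embed (X n)) \<longlonglongrightarrow> z" for X z
  proof -
    let ?R = "rep_completion z"
    have "cauchy_rel ?R ?R" using Quotient3_rep_reflp[OF Quotient3_completion] .
    then have R: "Cauchy ?R" by simp
    have "abs_completion ?R = z" using Quotient3_abs_rep[OF Quotient3_completion] .
    with completion_embed_tendsto_abs[OF R] have "(\<lambda>n. completion_embed (?R n)) \<longlonglongrightarrow> z" by simp
    from tendsto_diff[OF X(2) this] have "(\<lambda>n. completion_embed (X n - ?R n)) \<longlonglongrightarrow> 0"
      by (simp add: linear_diff[OF linear_completion_embed])
    then have "(\<lambda>n. norm (completion_embed (X n - ?R n))) \<longlonglongrightarrow> 0" by (rule tendsto_norm_zero)
    then have "(\<lambda>n. X n - ?R n) \<longlonglongrightarrow> 0" by (simp add: tendsto_norm_zero_cancel)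
    from g.tendsto_zero[OF this] have 1: "(\<lambda>n. g (X n) - g (?R n)) \<longlonglongrightarrow> 0"
      by (simp add: g.diff)
    have "(\<lambda>n. g (?R n)) \<longlonglongrightarrow> h z"
      using Cauchy_convergent[OF g.Cauchy[OF R]] by (simp add: h_def convergent_LIMSEQ_iff)
    from tendsto_add[OF 1 this] show ?thesis by simp
  qed
  have "bounded_linear h"
  proof -
    obtain K where K: "\<And>x. norm (g x) \<le> norm x * K" using g.bounded by blast
    show ?thesis
    proof (rule bounded_linear_intro)
      fix z w :: "'x completion" and c :: real
      obtain Z where Z: "Cauchy Z" "(\<lambda>n. completion_embed (Z n)) \<longlonglongrightarrow> z"
        by (rule completion_sequence)
      obtain W where W: "Cauchy W" "(\<lambda>n. completion_embed (W n)) \<longlonglongrightarrow> w"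
        by (rule completion_sequence)
      have "(\<lambda>n. g (Z n + W n)) \<longlonglongrightarrow> h (z + w)"
        by (rule h) (use Z W in \<open>auto simp: completion_embed_add intro: Cauchy_add_seq tendsto_add\<close>)
      moreover have "(\<lambda>n. g (Z n + W n)) \<longlonglongrightarrow> h z + h w"
        unfolding g.add by (intro tendsto_add h Z W)
      ultimately show "h (z + w) = h z + h w" by (rule LIMSEQ_unique)
      have "(\<lambda>n. g (c *\<^sub>R Z n)) \<longlonglongrightarrow> h (c *\<^sub>R z)"
        by (rule h) (use Z in \<open>auto simp: completion_embed_scaleR intro: Cauchy_scaleR_seq tendsto_scaleR\<close>)
      moreover have "(\<lambda>n. g (c *\<^sub>R Z n)) \<longlonglongrightarrow> c *\<^sub>R h z"
        unfolding g.scaleR by (intro tendsto_scaleR tendsto_const h Z)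
      ultimately show "h (c *\<^sub>R z) = c *\<^sub>R h z" by (rule LIMSEQ_unique)
      have "(\<lambda>n. norm (Z n)) \<longlonglongrightarrow> norm z" using tendsto_norm[OF Z(2)] by simp
      then have "(\<lambda>n. norm (Z n) * K) \<longlonglongrightarrow> norm z * K" by (intro tendsto_mult tendsto_const)
      then show "norm (h z) \<le> norm z * K"
        using K by (intro LIMSEQ_le[OF tendsto_norm[OF h[OF Z]]]) auto
    qed
  qed
  moreover have "h (completion_embed x) = g x" for x
    using h[of "\<lambda>_. x" "completion_embed x"] by (simp add: Cauchy_def LIMSEQ_const_iff)
  ultimately show "\<exists>\<phi> :: 'x completion \<Rightarrow>\<^sub>L 'y. \<forall>x. blinfun_apply \<phi> (completion_embed x) = g x"
    by (intro exI[of _ "Blinfun h"]) (simp add: bounded_linear_Blinfun_apply)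
next
  fix \<phi> \<psi> :: "'x completion \<Rightarrow>\<^sub>L 'y"
  assume eq: "\<forall>x. blinfun_apply \<phi> (completion_embed x) = g x"
    "\<forall>x. blinfun_apply \<psi> (completion_embed x) = g x"
  show "\<phi> = \<psi>"
  proof (rule blinfun_eqI)
    fix z :: "'x completion"
    obtain Z where Z: "(\<lambda>n. completion_embed (Z n)) \<longlonglongrightarrow> z" by (rule completion_sequence)
    have "(\<lambda>n. g (Z n)) \<longlonglongrightarrow> blinfun_apply \<phi> z" "(\<lambda>n. g (Z n)) \<longlonglongrightarrow> blinfun_apply \<psi> z"
      using blinfun.tendsto[OF tendsto_const Z, of \<phi>] blinfun.tendsto[OF tendsto_const Z, of \<psi>] eq
      by simp_all
    then show "blinfun_apply \<phi> z = blinfun_apply \<psi> z" by (rule LIMSEQ_unique)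
  qed
qed


section \<open>The Lipschitz-free space\<close>

text \<open>A finite combination \<open>\<Sum>\<^sub>i \<lambda>\<^sub>i (\<delta>\<^bsub>p\<^sub>i\<^esub> - \<delta>\<^bsub>q\<^sub>i\<^esub>)\<close> is encoded by the list of the triples
  \<open>(\<lambda>\<^sub>i, p\<^sub>i, q\<^sub>i)\<close>.\<close>

definition mol_comb :: "(real \<times> 'a \<times> 'a) list \<Rightarrow> 'a \<Rightarrow> real" where
  "mol_comb ts = (\<lambda>x. \<Sum>(c, p, q)\<leftarrow>ts. c * (indicator {p} x - indicator {q} x))"

definition mol_cost :: "(real \<times> 'a::metric_space \<times> 'a) list \<Rightarrow> real" where
  "mol_cost ts = (\<Sum>(c, p, q)\<leftarrow>ts. \<bar>c\<bar> * dist p q)"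

typedef 'a molecule = "range (mol_comb :: (real \<times> 'a \<times> 'a) list \<Rightarrow> _)"
  morphisms mol_fun Molecule
  by blast

setup_lifting type_definition_molecule

lemma mol_comb_append: "mol_comb (ts @ us) x = mol_comb ts x + mol_comb us x"
  by (simp add: mol_comb_def)

lemma mol_comb_scale: "mol_comb (map (\<lambda>(c, p, q). (a * c, p, q)) ts) x = a * mol_comb ts x"
  by (induction ts) (auto simp: mol_comb_def algebra_simps)

lemma mol_cost_append: "mol_cost (ts @ us) = mol_cost ts + mol_cost us"
  by (simp add: mol_cost_def)

lemma mol_cost_scale: "mol_cost (map (\<lambda>(c, p, q). (a * c, p, q)) ts) = \<bar>a\<bar> * mol_cost ts"
  by (induction ts) (auto simp: mol_cost_def algebra_simps abs_mult)

lemma mol_cost_nonneg: "mol_cost ts \<ge> 0"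
  by (induction ts) (auto simp: mol_cost_def)

text \<open>The finite sum \<open>\<Sum>\<^bsub>p\<in>M\<^esub> f(p) \<mu>(p)\<close>, taken over the support of \<open>\<mu>\<close>.\<close>

definition mol_pairing :: "('a \<Rightarrow> real) \<Rightarrow> 'a molecule \<Rightarrow> real" where
  "mol_pairing f \<mu> = (\<Sum>p | mol_fun \<mu> p \<noteq> 0. f p * mol_fun \<mu> p)"

lemma mol_comb_outside:
  assumes "x \<notin> (\<Union>(c, p, q)\<in>set ts. {p, q})" shows "mol_comb ts x = 0"
  using assms by (induction ts) (auto simp: mol_comb_def indicator_def)

lemma sum_mol_comb:
  assumes "finite A" "\<And>c p q. (c, p, q) \<in> set ts \<Longrightarrow> p \<in> A \<and> q \<in> A"
  shows "(\<Sum>x\<in>A. f x * mol_comb ts x) = (\<Sum>(c, p, q)\<leftarrow>ts. c * (f p - f q))"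
  using assms(2)
proof (induction ts)
  case Nil
  then show ?case by (simp add: mol_comb_def)
next
  case (Cons t ts)
  obtain c p q where t: "t = (c, p, q)" by (cases t)
  have A: "p \<in> A" "q \<in> A" using Cons.prems[of c p q] t by auto
  have IH: "(\<Sum>x\<in>A. f x * mol_comb ts x) = (\<Sum>(c, p, q)\<leftarrow>ts. c * (f p - f q))"
    using Cons by auto
  have "(\<Sum>x\<in>A. f x * mol_comb (t # ts) x) =
      (\<Sum>x\<in>A. c * (f x * indicator {p} x - f x * indicator {q} x) + f x * mol_comb ts x)"
    by (rule sum.cong) (auto simp: t mol_comb_def algebra_simps)
  also have "\<dots> = c * ((\<Sum>x\<in>A. f x * indicator {p} x) - (\<Sum>x\<in>A. f x * indicator {q} x))
      + (\<Sum>x\<in>A. f x * mol_comb ts x)"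
    by (simp add: sum.distrib sum_subtractf sum_distrib_left[symmetric])
  also have "(\<Sum>x\<in>A. f x * indicator {p} x) = f p"
    using assms(1) A by (simp add: indicator_def if_distrib cong: if_cong)
  also have "(\<Sum>x\<in>A. f x * indicator {q} x) = f q"
    using assms(1) A by (simp add: indicator_def if_distrib cong: if_cong)
  finally show ?case using IH by (simp add: t)
qed

lemma mol_pairing_eq:
  assumes "mol_fun \<mu> = mol_comb ts"
  shows "mol_pairing f \<mu> = (\<Sum>(c, p, q)\<leftarrow>ts. c * (f p - f q))"
proof -
  define A where "A = (\<Union>(c, p, q)\<in>set ts. {p, q})"
  have fin: "finite A" unfolding A_def by auto
  have mem: "p \<in> A \<and> q \<in> A" if "(c, p, q) \<in> set ts" for c p q
    unfolding A_def using that by force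
  have "mol_comb ts x = 0" if "x \<notin> A" for x
    using mol_comb_outside that unfolding A_def .
  then have "mol_pairing f \<mu> = (\<Sum>x\<in>A. f x * mol_comb ts x)"
    unfolding mol_pairing_def assms by (intro sum.mono_neutral_left fin) auto
  then show ?thesis using sum_mol_comb[OF fin mem] by simp
qed

lemma molecule_rep:
  obtains ts where "mol_fun \<mu> = mol_comb ts"
  using mol_fun[of \<mu>] by auto

lemma mol_pairing_cost:
  assumes "mol_fun \<mu> = mol_comb ts" "L-lipschitz_on UNIV f"
  shows "\<bar>mol_pairing f \<mu>\<bar> \<le> L * mol_cost ts"
proof -
  have "\<bar>\<Sum>(c, p, q)\<leftarrow>ts. c * (f p - f q)\<bar> \<le> L * mol_cost ts"
  proof (induction ts)
    case Nil
    then show ?case by (simp add: mol_cost_def)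
  next
    case (Cons t ts)
    obtain c p q where t: "t = (c, p, q)" by (cases t)
    have "\<bar>c * (f p - f q)\<bar> \<le> \<bar>c\<bar> * (L * dist p q)"
      using lipschitz_onD[OF assms(2), of p q]
      by (auto simp: abs_mult dist_real_def intro: mult_left_mono)
    with Cons show ?case by (simp add: t mol_cost_def algebra_simps)
  qed
  then show ?thesis using mol_pairing_eq[OF assms(1)] by simp
qed

instantiation molecule :: (metric_space) real_normed_vector
begin

lift_definition zero_molecule :: "'a molecule" is "\<lambda>_. 0"
  by (rule image_eqI[of _ _ "[]"]) (simp_all add: mol_comb_def)

lift_definition plus_molecule :: "'a molecule \<Rightarrow> 'a molecule \<Rightarrow> 'a molecule"
  is "\<lambda>\<mu> \<nu> x. \<mu> x + \<nu> x"
  by (auto simp: mol_comb_append[symmetric])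

lift_definition scaleR_molecule :: "real \<Rightarrow> 'a molecule \<Rightarrow> 'a molecule"
  is "\<lambda>c \<mu> x. c * \<mu> x"
  by (auto simp: mol_comb_scale[symmetric])

definition uminus_molecule :: "'a molecule \<Rightarrow> 'a molecule" where
  "uminus_molecule \<mu> = (-1) *\<^sub>R \<mu>"

definition minus_molecule :: "'a molecule \<Rightarrow> 'a molecule \<Rightarrow> 'a molecule" where
  "minus_molecule \<mu> \<nu> = \<mu> + - \<nu>"

definition norm_molecule :: "'a molecule \<Rightarrow> real" where
  "norm_molecule \<mu> = Inf {mol_cost ts | ts. mol_fun \<mu> = mol_comb ts}"

definition dist_molecule :: "'a molecule \<Rightarrow> 'a molecule \<Rightarrow> real" where
  "dist_molecule x y = norm (x - y)"

definition sgn_molecule :: "'a molecule \<Rightarrow> 'a molecule" where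
  "sgn_molecule x = inverse (norm x) *\<^sub>R x"

definition uniformity_molecule :: "('a molecule \<times> 'a molecule) filter" where
  "uniformity_molecule = (INF e\<in>{0 <..}. principal {(x, y). dist x y < e})"

definition open_molecule :: "'a molecule set \<Rightarrow> bool" where
  "open_molecule U = (\<forall>x\<in>U. eventually (\<lambda>(x', y). x' = x \<longrightarrow> y \<in> U) uniformity)"

lemma norm_molecule_le: "mol_fun \<mu> = mol_comb ts \<Longrightarrow> norm \<mu> \<le> mol_cost ts"
  unfolding norm_molecule_def
  by (rule cInf_lower) (auto intro!: bdd_belowI[of _ 0] mol_cost_nonneg)

lemma norm_molecule_ge:
  assumes "\<And>ts. mol_fun \<mu> = mol_comb ts \<Longrightarrow> K \<le> mol_cost ts" shows "K \<le> norm \<mu>"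
  unfolding norm_molecule_def
  by (rule cInf_greatest) (use assms molecule_rep[of \<mu>] in auto)

lemma mol_pairing_norm:
  fixes \<mu> :: "'a molecule"
  assumes f: "L-lipschitz_on UNIV f" shows "\<bar>mol_pairing f \<mu>\<bar> \<le> L * norm \<mu>"
proof -
  have L: "L \<ge> 0" using lipschitz_on_nonneg[OF f] .
  show ?thesis
  proof (cases "L = 0")
    case True
    then show ?thesis using mol_pairing_cost[OF _ f] molecule_rep[of \<mu>] by (metis mult_zero_left)
  next
    case False
    then have "L > 0" using L by simp
    have "\<bar>mol_pairing f \<mu>\<bar> / L \<le> norm \<mu>"
      by (rule norm_molecule_ge)
        (use mol_pairing_cost[OF _ f] \<open>L > 0\<close> in \<open>auto simp: divide_le_eq mult.commute\<close>)
    then show ?thesis using \<open>L > 0\<close> by (simp add: divide_le_eq mult.commute)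
  qed
qed

lemma finite_mol_support: "finite {p. mol_fun \<mu> p \<noteq> 0}"
proof -
  obtain ts where ts: "mol_fun \<mu> = mol_comb ts" by (rule molecule_rep)
  have "{p. mol_fun \<mu> p \<noteq> 0} \<subseteq> (\<Union>(c, p, q)\<in>set ts. {p, q})"
  proof (rule subsetI, rule ccontr)
    fix x assume "x \<in> {p. mol_fun \<mu> p \<noteq> 0}" and x: "x \<notin> (\<Union>(c, p, q)\<in>set ts. {p, q})"
    with mol_comb_outside[OF x] \<open>x \<in> {p. mol_fun \<mu> p \<noteq> 0}\<close> ts show False by simp
  qed
  then show ?thesis by (rule finite_subset) auto
qed

instance
proof
  fix x y z :: "'a molecule" and a b :: real
  show "x + y + z = x + (y + z)" by transfer (simp add: add.assoc)
  show "x + y = y + x" by transfer (simp add: add.commute)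
  show "0 + x = x" by transfer simp
  show "- x + x = 0" unfolding uminus_molecule_def by transfer simp
  show "x - y = x + - y" by (fact minus_molecule_def)
  show "a *\<^sub>R (x + y) = a *\<^sub>R x + a *\<^sub>R y" by transfer (simp add: distrib_left)
  show "(a + b) *\<^sub>R x = a *\<^sub>R x + b *\<^sub>R x" by transfer (simp add: distrib_right)
  show "a *\<^sub>R b *\<^sub>R x = (a * b) *\<^sub>R x" by transfer (simp add: mult.assoc)
  show one: "1 *\<^sub>R x = x" by transfer simp
  show "dist x y = norm (x - y)" by (fact dist_molecule_def)
  show "sgn x = inverse (norm x) *\<^sub>R x" by (fact sgn_molecule_def)
  show "uniformity = (INF e\<in>{0 <..}. principal {(x, y :: 'a molecule). dist x y < e})"
    by (fact uniformity_molecule_def)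
  show "open U = (\<forall>x\<in>U. eventually (\<lambda>(x', y). x' = x \<longrightarrow> y \<in> U) uniformity)"
    for U :: "'a molecule set" by (fact open_molecule_def)
  have nonneg: "norm x \<ge> 0" for x :: "'a molecule"
    by (rule norm_molecule_ge) (rule mol_cost_nonneg)
  have zero: "norm (0 :: 'a molecule) = 0"
  proof (rule antisym[OF _ nonneg])
    have "norm (0 :: 'a molecule) \<le> mol_cost ([] :: (real \<times> 'a \<times> 'a) list)"
      by (rule norm_molecule_le) (auto simp: zero_molecule.rep_eq mol_comb_def)
    then show "norm (0 :: 'a molecule) \<le> 0" by (simp add: mol_cost_def)
  qed
  show "norm x = 0 \<longleftrightarrow> x = 0"
  proof
    assume n0: "norm x = 0"
    have "mol_fun x p = 0" for p
    proof (rule ccontr)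
      assume p: "mol_fun x p \<noteq> 0"
      let ?S = "{q. mol_fun x q \<noteq> 0} - {p}"
      have fin: "finite ?S" using finite_mol_support[of x] by simp
      obtain r where r: "r > 0" "\<forall>q\<in>?S. r \<le> dist p q"
        using finite_set_avoid[OF fin, of p] by auto
      define f where "f q = max 0 (r - dist q p)" for q
      have "1-lipschitz_on UNIV f"
      proof (rule lipschitz_onI)
        fix u v :: 'a
        show "dist (f u) (f v) \<le> 1 * dist u v"
          using dist_triangle[of u p v] dist_triangle[of v p u]
          by (auto simp: f_def dist_real_def dist_commute)
      qed simp
      from mol_pairing_norm[OF this, of x] n0 have "mol_pairing f x = 0" by simp
      moreover have "mol_pairing f x = f p * mol_fun x p"
      proof -
        have "mol_pairing f x = (\<Sum>q\<in>{p}. f q * mol_fun x q)"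
          unfolding mol_pairing_def
        proof (rule sum.mono_neutral_right)
          show "\<forall>i\<in>{p. mol_fun x p \<noteq> 0} - {p}. f i * mol_fun x i = 0"
            using r by (auto simp: f_def dist_commute)
        qed (use finite_mol_support[of x] p in auto)
        then show ?thesis by simp
      qed
      ultimately show False using p r by (simp add: f_def)
    qed
    then show "x = 0" by transfer auto
  qed (simp add: zero)
  show "norm (x + y) \<le> norm x + norm y"
  proof -
    have "norm (x + y) - norm y \<le> norm x"
    proof (rule norm_molecule_ge)
      fix ts assume ts: "mol_fun x = mol_comb ts"
      have "norm (x + y) - mol_cost ts \<le> norm y"
      proof (rule norm_molecule_ge)
        fix us assume us: "mol_fun y = mol_comb us"
        have "norm (x + y) \<le> mol_cost (ts @ us)"
          by (rule norm_molecule_le) (auto simp: plus_molecule.rep_eq ts us mol_comb_append)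
        then show "norm (x + y) - mol_cost ts \<le> mol_cost us" by (simp add: mol_cost_append)
      qed
      then show "norm (x + y) - norm y \<le> mol_cost ts" by simp
    qed
    then show ?thesis by simp
  qed
  have le: "norm (a *\<^sub>R x) \<le> \<bar>a\<bar> * norm x" if "a \<noteq> 0" for a and x :: "'a molecule"
  proof -
    have "norm (a *\<^sub>R x) / \<bar>a\<bar> \<le> norm x"
    proof (rule norm_molecule_ge)
      fix ts assume ts: "mol_fun x = mol_comb ts"
      have "norm (a *\<^sub>R x) \<le> mol_cost (map (\<lambda>(c, p, q). (a * c, p, q)) ts)"
        by (rule norm_molecule_le, rule ext) (simp only: scaleR_molecule.rep_eq ts mol_comb_scale)
      then have "norm (a *\<^sub>R x) \<le> \<bar>a\<bar> * mol_cost ts" by (simp only: mol_cost_scale)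
      then show "norm (a *\<^sub>R x) / \<bar>a\<bar> \<le> mol_cost ts"
        using that by (simp add: divide_le_eq mult.commute)
    qed
    then show ?thesis using that by (simp add: divide_le_eq mult.commute)
  qed
  show "norm (a *\<^sub>R x) = \<bar>a\<bar> * norm x"
  proof (cases "a = 0")
    case True
    have "0 *\<^sub>R x = 0" by transfer simp
    with True zero show ?thesis by simp
  next
    case False
    have "inverse a *\<^sub>R (a *\<^sub>R x) = x" using False one by (transfer) (simp add: mult.assoc[symmetric])
    with le[of "inverse a" "a *\<^sub>R x"] False have "norm x \<le> norm (a *\<^sub>R x) / \<bar>a\<bar>"
      by (simp add: divide_inverse mult.commute)
    then have "\<bar>a\<bar> * norm x \<le> norm (a *\<^sub>R x)" using False by (simp add: le_divide_eq mult.commute)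
    with le[OF False] show ?thesis by (intro antisym)
  qed
qed

end

type_synonym 'a lipfree = "'a molecule completion"


section \<open>The space of Lipschitz functions vanishing at the base point\<close>

class pointed_metric_space = metric_space +
  fixes base_point :: 'a

typedef (overloaded) 'a lip0 =
  "{f :: 'a::pointed_metric_space \<Rightarrow> real. (\<exists>L. L-lipschitz_on UNIV f) \<and> f base_point = 0}"
  morphisms lip0_fun Lip0
  by (rule exI[of _ "\<lambda>_. 0"]) (auto intro: lipschitz_on_constant)

setup_lifting type_definition_lip0

instantiation lip0 :: (pointed_metric_space) real_normed_vector
begin

lift_definition zero_lip0 :: "'a lip0" is "\<lambda>_. 0"
  by (auto intro: lipschitz_on_constant)

lift_definition plus_lip0 :: "'a lip0 \<Rightarrow> 'a lip0 \<Rightarrow> 'a lip0" is "\<lambda>f g x. f x + g x"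
  using lipschitz_on_add by fastforce

lift_definition scaleR_lip0 :: "real \<Rightarrow> 'a lip0 \<Rightarrow> 'a lip0" is "\<lambda>c f x. c * f x"
  using lipschitz_on_cmult_real by fastforce

definition uminus_lip0 :: "'a lip0 \<Rightarrow> 'a lip0" where
  "uminus_lip0 f = (-1) *\<^sub>R f"

definition minus_lip0 :: "'a lip0 \<Rightarrow> 'a lip0 \<Rightarrow> 'a lip0" where
  "minus_lip0 f g = f + - g"

text \<open>Pairs with \<open>x = y\<close> only contribute the quotient \<open>0 / 0 = 0\<close> to the supremum.\<close>

definition norm_lip0 :: "'a lip0 \<Rightarrow> real" where
  "norm_lip0 f = (SUP (x, y). \<bar>lip0_fun f x - lip0_fun f y\<bar> / dist x y)"

definition dist_lip0 :: "'a lip0 \<Rightarrow> 'a lip0 \<Rightarrow> real" where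
  "dist_lip0 x y = norm (x - y)"

definition sgn_lip0 :: "'a lip0 \<Rightarrow> 'a lip0" where
  "sgn_lip0 x = inverse (norm x) *\<^sub>R x"

definition uniformity_lip0 :: "('a lip0 \<times> 'a lip0) filter" where
  "uniformity_lip0 = (INF e\<in>{0 <..}. principal {(x, y). dist x y < e})"

definition open_lip0 :: "'a lip0 set \<Rightarrow> bool" where
  "open_lip0 U = (\<forall>x\<in>U. eventually (\<lambda>(x', y). x' = x \<longrightarrow> y \<in> U) uniformity)"

lemma lip0_bdd: "bdd_above (range (\<lambda>(x, y). \<bar>lip0_fun f x - lip0_fun f y\<bar> / dist x y))"
proof -
  obtain L where L: "L-lipschitz_on UNIV (lip0_fun f)" using lip0_fun[of f] by auto
  show ?thesis
  proof (rule bdd_aboveI)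
    fix r assume "r \<in> range (\<lambda>(x, y). \<bar>lip0_fun f x - lip0_fun f y\<bar> / dist x y)"
    then obtain x y where "r = \<bar>lip0_fun f x - lip0_fun f y\<bar> / dist x y" by auto
    then show "r \<le> L"
      using lipschitz_onD[OF L, of x y] lipschitz_on_nonneg[OF L]
      by (cases "x = y") (auto simp: dist_real_def divide_le_eq)
  qed
qed

lemma lip0_norm_bound: "\<bar>lip0_fun f x - lip0_fun f y\<bar> \<le> norm f * dist x y"
proof (cases "x = y")
  case False
  have "\<bar>lip0_fun f x - lip0_fun f y\<bar> / dist x y \<le> norm f"
    unfolding norm_lip0_def using cSUP_upper[OF UNIV_I lip0_bdd[of f], of "(x, y)"] by simp
  then show ?thesis using False by (simp add: divide_le_eq)
qed simp

lemma lip0_norm_nonneg: "norm (f :: 'a lip0) \<ge> 0"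
  unfolding norm_lip0_def using cSUP_upper[OF UNIV_I lip0_bdd[of f], of "(base_point, base_point)"] by simp

lemma lip0_norm_lipschitz: "(norm f)-lipschitz_on UNIV (lip0_fun f)"
  by (rule lipschitz_onI) (auto simp: dist_real_def lip0_norm_bound lip0_norm_nonneg)

lemma lip0_norm_least:
  assumes "K \<ge> 0" "\<And>x y. \<bar>lip0_fun f x - lip0_fun f y\<bar> \<le> K * dist x y"
  shows "norm f \<le> K"
  unfolding norm_lip0_def
proof (rule cSUP_least)
  fix t :: "'a \<times> 'a"
  show "(case t of (x, y) \<Rightarrow> \<bar>lip0_fun f x - lip0_fun f y\<bar> / dist x y) \<le> K"
    using assms by (cases t; cases "fst t = snd t") (auto simp: divide_le_eq)
qed simp

instance
proof
  fix x y z :: "'a lip0" and a b :: real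
  show "x + y + z = x + (y + z)" by transfer (simp add: add.assoc)
  show "x + y = y + x" by transfer (simp add: add.commute)
  show "0 + x = x" by transfer simp
  show "- x + x = 0" unfolding uminus_lip0_def by transfer simp
  show "x - y = x + - y" by (fact minus_lip0_def)
  show "a *\<^sub>R (x + y) = a *\<^sub>R x + a *\<^sub>R y" by transfer (simp add: distrib_left)
  show "(a + b) *\<^sub>R x = a *\<^sub>R x + b *\<^sub>R x" by transfer (simp add: distrib_right)
  show "a *\<^sub>R b *\<^sub>R x = (a * b) *\<^sub>R x" by transfer (simp add: mult.assoc)
  show "1 *\<^sub>R x = x" by transfer simp
  show "dist x y = norm (x - y)" by (fact dist_lip0_def)
  show "sgn x = inverse (norm x) *\<^sub>R x" by (fact sgn_lip0_def)
  show "uniformity = (INF e\<in>{0 <..}. principal {(x, y :: 'a lip0). dist x y < e})"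
    by (fact uniformity_lip0_def)
  show "open U = (\<forall>x\<in>U. eventually (\<lambda>(x', y). x' = x \<longrightarrow> y \<in> U) uniformity)"
    for U :: "'a lip0 set" by (fact open_lip0_def)
  show "norm x = 0 \<longleftrightarrow> x = 0"
  proof
    assume n0: "norm x = 0"
    have "lip0_fun x p = 0" for p
      using lip0_norm_bound[of x p base_point] lip0_fun[of x] n0 by simp
    then show "x = 0" by transfer auto
  next
    assume "x = 0"
    then have "norm x \<le> 0" by (intro lip0_norm_least) (auto simp: zero_lip0.rep_eq)
    then show "norm x = 0" using lip0_norm_nonneg[of x] by simp
  qed
  show "norm (x + y) \<le> norm x + norm y"
  proof (rule lip0_norm_least)
    fix p q
    show "\<bar>lip0_fun (x + y) p - lip0_fun (x + y) q\<bar> \<le> (norm x + norm y) * dist p q"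
      using lip0_norm_bound[of x p q] lip0_norm_bound[of y p q]
      by (simp add: plus_lip0.rep_eq distrib_right)
  qed (simp add: lip0_norm_nonneg)
  show "norm (a *\<^sub>R x) = \<bar>a\<bar> * norm x"
  proof (rule antisym)
    show "norm (a *\<^sub>R x) \<le> \<bar>a\<bar> * norm x"
    proof (rule lip0_norm_least)
      fix p q
      show "\<bar>lip0_fun (a *\<^sub>R x) p - lip0_fun (a *\<^sub>R x) q\<bar> \<le> \<bar>a\<bar> * norm x * dist p q"
        using mult_left_mono[OF lip0_norm_bound[of x p q], of "\<bar>a\<bar>"]
        by (simp add: scaleR_lip0.rep_eq abs_mult[symmetric] right_diff_distrib mult.assoc)
    qed (simp add: lip0_norm_nonneg)
    show "\<bar>a\<bar> * norm x \<le> norm (a *\<^sub>R x)"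
    proof (cases "a = 0")
      case False
      have "norm x \<le> norm (a *\<^sub>R x) / \<bar>a\<bar>"
      proof (rule lip0_norm_least)
        fix p q
        have "\<bar>a\<bar> * \<bar>lip0_fun x p - lip0_fun x q\<bar> \<le> norm (a *\<^sub>R x) * dist p q"
          using lip0_norm_bound[of "a *\<^sub>R x" p q]
          by (simp add: scaleR_lip0.rep_eq abs_mult[symmetric] right_diff_distrib)
        then show "\<bar>lip0_fun x p - lip0_fun x q\<bar> \<le> norm (a *\<^sub>R x) / \<bar>a\<bar> * dist p q"
          using False by (simp add: le_divide_eq mult.commute)
      qed (simp add: lip0_norm_nonneg)
      then show ?thesis using False by (simp add: le_divide_eq mult.commute)
    qed (simp add: lip0_norm_nonneg)
  qed
qed

end

text \<open>The functional on the Lipschitz-free space that extends the pairing with \<open>f\<close> by continuity.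
  It exists and is unique by \<open>completion_extension\<close>, see \<open>lip0_functional_embed\<close>; by
  \<open>linear_lip0_functional\<close>, \<open>norm_lip0_functional\<close> and \<open>surj_lip0_functional\<close> the map
  \<open>lip0_functional\<close> is the isometric isomorphism of the space of Lipschitz functions onto the dual
  of the Lipschitz-free space.\<close>

definition lip0_functional :: "'a::pointed_metric_space lip0 \<Rightarrow> 'a lipfree \<Rightarrow>\<^sub>L real" where
  "lip0_functional f =
    (THE \<phi>. \<forall>\<mu>. blinfun_apply \<phi> (completion_embed \<mu>) = mol_pairing (lip0_fun f) \<mu>)"

lemma mol_pairing_add: "mol_pairing f (\<mu> + \<nu>) = mol_pairing f \<mu> + mol_pairing f \<nu>"
proof -
  obtain ts us where ts: "mol_fun \<mu> = mol_comb ts" and us: "mol_fun \<nu> = mol_comb us"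
    by (metis molecule_rep)
  have "mol_fun (\<mu> + \<nu>) = mol_comb (ts @ us)"
    by (auto simp: plus_molecule.rep_eq ts us mol_comb_append)
  from mol_pairing_eq[OF this] mol_pairing_eq[OF ts] mol_pairing_eq[OF us] show ?thesis by simp
qed

lemma mol_pairing_scaleR:
  fixes \<mu> :: "'a::metric_space molecule"
  shows "mol_pairing f (c *\<^sub>R \<mu>) = c * mol_pairing f \<mu>"
  by (cases "c = 0") (simp_all add: mol_pairing_def scaleR_molecule.rep_eq zero_molecule.rep_eq sum_distrib_left mult_ac)

lemma lip0_functional_embed:
  "blinfun_apply (lip0_functional f) (completion_embed \<mu>) = mol_pairing (lip0_fun f) \<mu>"
proof -
  have "bounded_linear (mol_pairing (lip0_fun f))"
  proof (rule bounded_linear_intro)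
    fix \<mu> :: "'a molecule"
    show "norm (mol_pairing (lip0_fun f) \<mu>) \<le> norm \<mu> * norm f"
      using mol_pairing_norm[OF lip0_norm_lipschitz, of f \<mu>] by (simp add: mult.commute)
  qed (simp_all add: mol_pairing_add mol_pairing_scaleR)
  from theI'[OF completion_extension[OF this]] show ?thesis
    unfolding lip0_functional_def by blast
qed

lemma lipfree_functional_eqI:
  fixes \<phi> \<psi> :: "'x::real_normed_vector completion \<Rightarrow>\<^sub>L 'y::banach"
  assumes "\<And>\<mu>. blinfun_apply \<phi> (completion_embed \<mu>) = blinfun_apply \<psi> (completion_embed \<mu>)"
  shows "\<phi> = \<psi>"
proof -
  have "bounded_linear (\<lambda>\<mu>. blinfun_apply \<psi> (completion_embed \<mu>))"
    by (intro bounded_linear_compose[OF blinfun.bounded_linear_right bounded_linear_completion_embed])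
  from completion_extension[OF this] assms show ?thesis by blast
qed

lemma linear_lip0_functional:
  "linear (lip0_functional :: 'a::pointed_metric_space lip0 \<Rightarrow> _)"
proof (rule linearI)
  fix f g :: "'a lip0" and c :: real
  show "lip0_functional (f + g) = lip0_functional f + lip0_functional g"
    by (rule lipfree_functional_eqI)
      (simp add: lip0_functional_embed blinfun.add_left mol_pairing_def plus_lip0.rep_eq
        distrib_right sum.distrib)
  show "lip0_functional (c *\<^sub>R f) = c *\<^sub>R lip0_functional f"
    by (rule lipfree_functional_eqI)
      (simp add: lip0_functional_embed blinfun.scaleR_left mol_pairing_def scaleR_lip0.rep_eq
        sum_distrib_left mult.assoc)
qed

definition elem_mol :: "'a \<Rightarrow> 'a \<Rightarrow> 'a molecule" where
  "elem_mol p q = Molecule (mol_comb [(1, p, q)])"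

lemma mol_fun_elem_mol: "mol_fun (elem_mol p q) = mol_comb [(1, p, q)]"
  unfolding elem_mol_def by (rule Molecule_inverse) blast

lemma norm_elem_mol_le: "norm (elem_mol p q) \<le> dist p q"
  using norm_molecule_le[OF mol_fun_elem_mol, of p q] by (simp add: mol_cost_def)

lemma mol_pairing_elem_mol: "mol_pairing f (elem_mol p q) = f p - f q"
  using mol_pairing_eq[OF mol_fun_elem_mol, of f p q] by simp

lemma norm_lip0_functional:
  fixes f :: "'a::pointed_metric_space lip0"
  shows "norm (lip0_functional f) = norm f"
proof (rule antisym)
  show "norm (lip0_functional f) \<le> norm f"
  proof (rule norm_blinfun_bound)
    fix z :: "'a lipfree"
    obtain Z where Z: "(\<lambda>n. completion_embed (Z n)) \<longlonglongrightarrow> z" by (rule completion_sequence)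
    have "(\<lambda>n. norm (blinfun_apply (lip0_functional f) (completion_embed (Z n))))
        \<longlonglongrightarrow> norm (blinfun_apply (lip0_functional f) z)"
      by (intro tendsto_norm blinfun.tendsto tendsto_const Z)
    moreover have "(\<lambda>n. norm f * norm (completion_embed (Z n))) \<longlonglongrightarrow> norm f * norm z"
      by (intro tendsto_mult tendsto_const tendsto_norm Z)
    ultimately show "norm (blinfun_apply (lip0_functional f) z) \<le> norm f * norm z"
      using mol_pairing_norm[OF lip0_norm_lipschitz, of f]
      by (intro LIMSEQ_le) (auto simp: lip0_functional_embed)
  qed simp
  show "norm f \<le> norm (lip0_functional f)"
  proof (rule lip0_norm_least)
    fix p q
    have "\<bar>lip0_fun f p - lip0_fun f q\<bar> =
        norm (blinfun_apply (lip0_functional f) (completion_embed (elem_mol p q)))"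
      by (simp add: lip0_functional_embed mol_pairing_elem_mol)
    also have "\<dots> \<le> norm (lip0_functional f) * norm (elem_mol p q)"
      using norm_blinfun[of "lip0_functional f" "completion_embed (elem_mol p q)"] by simp
    also have "\<dots> \<le> norm (lip0_functional f) * dist p q"
      by (intro mult_left_mono norm_elem_mol_le) simp
    finally show "\<bar>lip0_fun f p - lip0_fun f q\<bar> \<le> norm (lip0_functional f) * dist p q" .
  qed simp
qed

lemma surj_lip0_functional:
  "surj (lip0_functional :: 'a::pointed_metric_space lip0 \<Rightarrow> _)"
proof (rule surjI)
  fix \<phi> :: "'a lipfree \<Rightarrow>\<^sub>L real"
  let ?e = "\<lambda>p q. completion_embed (elem_mol p q) :: 'a lipfree"
  define f where "f p = blinfun_apply \<phi> (?e p base_point)" for p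
  have diff: "f p - f q = blinfun_apply \<phi> (?e p q)" for p q
  proof -
    have "elem_mol p base_point = elem_mol p q + elem_mol q base_point"
      by (rule mol_fun_inject[THEN iffD1])
        (auto simp: plus_molecule.rep_eq mol_fun_elem_mol mol_comb_def)
    then show ?thesis by (simp add: f_def completion_embed_add blinfun.add_right)
  qed
  have "(norm \<phi>)-lipschitz_on UNIV f"
  proof (rule lipschitz_onI)
    fix p q
    have "dist (f p) (f q) \<le> norm \<phi> * norm (elem_mol p q)"
      using norm_blinfun[of \<phi> "?e p q"] by (simp add: dist_real_def diff)
    also have "\<dots> \<le> norm \<phi> * dist p q" by (intro mult_left_mono norm_elem_mol_le) simp
    finally show "dist (f p) (f q) \<le> norm \<phi> * dist p q" .
  qed simp
  moreover have "f base_point = 0" using diff[of base_point base_point]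
  proof -
    have "elem_mol base_point base_point = (0 :: 'a molecule)"
      by (rule mol_fun_inject[THEN iffD1])
        (auto simp: zero_molecule.rep_eq mol_fun_elem_mol mol_comb_def)
    then show ?thesis
      by (simp add: f_def linear_0[OF linear_completion_embed] blinfun.zero_right)
  qed
  ultimately have f: "lip0_fun (Lip0 f) = f" by (intro Lip0_inverse) auto
  have "mol_pairing f \<mu> = blinfun_apply \<phi> (completion_embed \<mu>)" for \<mu>
  proof -
    obtain ts where ts: "mol_fun \<mu> = mol_comb ts" by (rule molecule_rep)
    have "(\<Sum>(c, p, q)\<leftarrow>ts. c * (f p - f q)) = blinfun_apply \<phi> (completion_embed \<mu>)"
      using ts
    proof (induction ts arbitrary: \<mu>)
      case Nil
      then have "\<mu> = 0"
        by (intro mol_fun_inject[THEN iffD1]) (auto simp: zero_molecule.rep_eq mol_comb_def)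
      then show ?case by (simp add: linear_0[OF linear_completion_embed] blinfun.zero_right)
    next
      case (Cons t ts)
      obtain c p q where t: "t = (c, p, q)" by (cases t)
      define \<nu> where "\<nu> = Molecule (mol_comb ts)"
      have \<nu>: "mol_fun \<nu> = mol_comb ts" unfolding \<nu>_def by (rule Molecule_inverse) blast
      have "\<mu> = c *\<^sub>R elem_mol p q + \<nu>"
        by (rule mol_fun_inject[THEN iffD1])
          (auto simp: Cons.prems t plus_molecule.rep_eq scaleR_molecule.rep_eq \<nu> mol_fun_elem_mol
            mol_comb_def)
      with Cons.IH[OF \<nu>] show ?case
        by (simp add: t completion_embed_add completion_embed_scaleR blinfun.add_right
            blinfun.scaleR_right diff)
    qed
    then show ?thesis using mol_pairing_eq[OF ts] by simp
  qed
  then show "lip0_functional (Lip0 f) = \<phi>"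
    by (intro lipfree_functional_eqI) (simp add: lip0_functional_embed f)
qed

instance lip0 :: (pointed_metric_space) banach
proof
  fix F :: "nat \<Rightarrow> 'a lip0" assume "Cauchy F"
  have d: "dist (lip0_functional f) (lip0_functional g) = dist f g" for f g :: "'a lip0"
    by (simp add: dist_norm linear_diff[OF linear_lip0_functional, symmetric] norm_lip0_functional)
  from \<open>Cauchy F\<close> have "Cauchy (\<lambda>n. lip0_functional (F n))" by (simp add: Cauchy_def d)
  then obtain \<phi> where "(\<lambda>n. lip0_functional (F n)) \<longlonglongrightarrow> \<phi>"
    by (metis Cauchy_convergent convergent_def)
  moreover obtain f where "\<phi> = lip0_functional f" using surj_lip0_functional by (metis surjD)
  ultimately have "F \<longlonglongrightarrow> f" by (simp add: lim_sequentially d)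
  then show "convergent F" by (rule convergentI)
qed


section \<open>The three properties\<close>

text \<open>A Banach space \<open>Z\<close> is regarded as the dual of \<open>X\<close> by means of an isometric isomorphism
  \<open>\<Phi>\<close> from \<open>Z\<close> onto the space of bounded functionals on \<open>X\<close>; the dual itself is the case
  \<open>\<Phi> = id\<close>.\<close>

definition weak_star_slice ::
    "('z::banach \<Rightarrow> ('x::banach \<Rightarrow>\<^sub>L real)) \<Rightarrow> 'x \<Rightarrow> real \<Rightarrow> 'z set" where
  "weak_star_slice \<Phi> x \<alpha> = {f \<in> cball 0 1. blinfun_apply (\<Phi> f) x > 1 - \<alpha>}"

definition weak_star_SSD2P :: "('z::banach \<Rightarrow> ('x::banach \<Rightarrow>\<^sub>L real)) \<Rightarrow> bool" where
  "weak_star_SSD2P \<Phi> \<longleftrightarrow>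
    (\<forall>(n::nat) S. (\<forall>i\<in>{1..n}. \<exists>x\<in>sphere 0 1. \<exists>\<alpha>>0. S i = weak_star_slice \<Phi> x \<alpha>) \<longrightarrow>
      (\<forall>\<epsilon>>0. \<exists>f. \<exists>g\<in>cball 0 1.
        (\<forall>i\<in>{1..n}. f i \<in> S i \<and> f i + g \<in> S i \<and> f i - g \<in> S i) \<and> norm g > 1 - \<epsilon>))"

definition decomposably_octahedral :: "'x::banach itself \<Rightarrow> bool" where
  "decomposably_octahedral _ \<longleftrightarrow>
    (\<forall>E \<subseteq> sphere (0::'x) 1. finite E \<longrightarrow> (\<forall>\<epsilon>>0. \<exists>y\<in>sphere (0::'x) 1.
      \<forall>(n::nat) (ys :: nat \<Rightarrow> 'x) (xs :: nat \<Rightarrow> 'x) a b.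
        (\<Sum>i=1..n. ys i) = y \<longrightarrow>
        (\<forall>i\<in>{1..n}. xs i \<in> E \<and> a i \<ge> 0 \<and> b i \<ge> 0) \<longrightarrow>
        (\<Sum>i=1..n. norm (a i *\<^sub>R xs i + ys i) + norm (b i *\<^sub>R xs i - ys i))
          \<ge> (1 - \<epsilon>) * ((\<Sum>i=1..n. a i + b i) + 2)))"

definition strong_long_trapezoid :: "'a::metric_space set \<Rightarrow> bool" where
  "strong_long_trapezoid M \<longleftrightarrow>
    (\<forall>N \<subseteq> M. finite N \<longrightarrow> (\<forall>\<epsilon>>0. \<exists>u\<in>M. \<exists>v\<in>M. u \<noteq> v \<and>
      (\<forall>x\<in>N. \<forall>y\<in>N. (1 - \<epsilon>) * (dist x y + dist u v) \<le> dist x u + dist y v) \<and>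
      (\<forall>x\<in>N. \<forall>y\<in>N. \<forall>z\<in>N. \<forall>w\<in>N.
        (1 - \<epsilon>) * (dist x y + dist z w + 2 * dist u v)
          \<le> dist x u + dist y u + dist z v + dist w v)))"

end

theory Submission
  imports Defs
begin

text \<open>The three properties are proved equivalent in a cycle.

  From the weak* symmetric strong diameter 2 property to octahedrality: a common perturbation
  \<open>g\<close> of functions \<open>f\<close> in slices is tested against a vector
  \<open>y\<close> at which \<open>g\<close> almost attains its norm. The norms in a decomposition
  are bounded below by means of \<open>f + g\<close> and \<open>f - g\<close>, and the contribution
  of \<open>f\<close> to the summands of \<open>y\<close> cancels
  (\<open>weak_star_SSD2P_imp_decomposably_octahedral\<close>).

  From octahedrality to the trapezoid property: if for a finite set \<open>N\<close> every pair
  \<open>u \<noteq> v\<close> violates one of the trapezoid inequalities, then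
  \<open>\<delta>\<^bsub>u\<^esub> - \<delta>\<^bsub>v\<^esub>\<close> has a decomposition over the
  normalised differences of point masses of \<open>N\<close> that is too cheap by a factor less than
  \<open>1\<close>. For the inequality with two points this is a regrouping of four point masses.
  For the inequality with four points the difference is routed through the midpoints
  \<open>(\<delta>\<^bsub>x\<^esub> + \<delta>\<^bsub>y\<^esub>)/2\<close> and
  \<open>(\<delta>\<^bsub>z\<^esub> + \<delta>\<^bsub>w\<^esub>)/2\<close>; the part between the
  midpoints is supported on \<open>N\<close> and can be decomposed at a cost that equals its
  coefficients. Cheap decompositions add up, so every molecule has one, which contradicts
  octahedrality (\<open>decomposition_cost_bad_pair\<close>,
  \<open>decomposition_cost_bad_quadruple\<close>,
  \<open>decomposably_octahedral_imp_strong_long_trapezoid\<close>).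

  From the trapezoid property to the diameter property: given finitely many slices, let
  \<open>N\<close> almost support the vectors that define them, and let \<open>u\<close>,
  \<open>v\<close> be a pair for \<open>N\<close>. The perturbation \<open>g\<close> is a positive
  cone over a ball around \<open>u\<close> minus a cone over a ball around \<open>v\<close>. The
  functions \<open>f\<close> are nearly norming on \<open>N\<close> and constant on both balls. The
  inequality with four points says that the radii can be chosen with sum almost
  \<open>d(u,v)\<close>, so that \<open>g\<close> has almost full slope; the inequality with two
  points says that the constants on the two balls can be chosen close enough to each other
  (\<open>trapezoid_bump\<close>). Norming functions exist by the Hahn--Banach theorem
  (\<open>norming_functional\<close>).\<close>

section \<open>Norming functionals\<close>

definition sublinear :: "('x::real_vector \<Rightarrow> real) \<Rightarrow> bool" where
  "sublinear p \<longleftrightarrow> (\<forall>x y. p (x + y) \<le> p x + p y) \<and> (\<forall>t>0. \<forall>x. p (t *\<^sub>R x) = t * p x)"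

lemma sublinear_add: "sublinear p \<Longrightarrow> p (x + y) \<le> p x + p y"
  by (simp add: sublinear_def)

lemma sublinear_scale: "sublinear p \<Longrightarrow> t \<ge> 0 \<Longrightarrow> p (t *\<^sub>R x) = t * p x"
proof (cases "t = 0")
  case True
  assume "sublinear p"
  then have "p (2 *\<^sub>R 0) = 2 * p 0" unfolding sublinear_def by (metis zero_less_numeral)
  then show ?thesis using True by simp
qed (simp add: sublinear_def)

lemma sublinear_zero: "sublinear p \<Longrightarrow> p 0 = 0"
  using sublinear_scale[of p 0 0] by simp

lemma sublinear_lower: "sublinear p \<Longrightarrow> - p (- x) \<le> p x"
  using sublinear_add[of p x "- x"] sublinear_zero[of p] by simp

text \<open>The largest sublinear functional below \<open>p\<close> whose value at \<open>-
  y\<close> is at most \<open>- p y\<close>. It serves twice: it shows that a minimal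
  \<open>p\<close> is additive, and it forces a linear functional below it to attain the value
  \<open>p y\<close> at \<open>y\<close>.\<close>

definition lower_along :: "('x::real_vector \<Rightarrow> real) \<Rightarrow> 'x \<Rightarrow> 'x \<Rightarrow> real" where
  "lower_along p y z = (INF t\<in>{0..}. p (z + t *\<^sub>R y) - t * p y)"

lemma lower_along_le:
  assumes p: "sublinear p" and t: "t \<ge> 0"
  shows "lower_along p y z \<le> p (z + t *\<^sub>R y) - t * p y"
  unfolding lower_along_def
proof (rule cINF_lower)
  show "bdd_below ((\<lambda>t. p (z + t *\<^sub>R y) - t * p y) ` {0..})"
  proof (rule bdd_belowI2[of _ "- p (- z)"])
    fix t :: real assume "t \<in> {0..}"
    then show "- p (- z) \<le> p (z + t *\<^sub>R y) - t * p y"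
      using sublinear_add[OF p, of "z + t *\<^sub>R y" "- z"] sublinear_scale[OF p, of t y] by simp
  qed
qed (use t in simp)

lemma lower_along_greatest:
  assumes "\<And>t. t \<ge> 0 \<Longrightarrow> m \<le> p (z + t *\<^sub>R y) - t * p y"
  shows "m \<le> lower_along p y z"
  unfolding lower_along_def by (rule cINF_greatest) (use assms in auto)

lemma sublinear_lower_along:
  assumes p: "sublinear p"
  shows "sublinear (lower_along p y)"
  unfolding sublinear_def
proof (intro conjI allI impI)
  fix x z
  have *: "lower_along p y (x + z) \<le> (p (x + s *\<^sub>R y) - s * p y) + (p (z + t *\<^sub>R y) - t * p y)"
    if "s \<ge> 0" "t \<ge> 0" for s t
    using lower_along_le[OF p, of "s + t" y "x + z"] that
      sublinear_add[OF p, of "x + s *\<^sub>R y" "z + t *\<^sub>R y"]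
    by (simp add: algebra_simps)
  have "lower_along p y (x + z) - lower_along p y x \<le> lower_along p y z"
  proof (rule lower_along_greatest)
    fix t :: real assume t: "t \<ge> 0"
    have "lower_along p y (x + z) - (p (z + t *\<^sub>R y) - t * p y) \<le> lower_along p y x"
      by (rule lower_along_greatest) (use *[OF _ t] in \<open>simp add: algebra_simps\<close>)
    then show "lower_along p y (x + z) - lower_along p y x \<le> p (z + t *\<^sub>R y) - t * p y" by simp
  qed
  then show "lower_along p y (x + z) \<le> lower_along p y x + lower_along p y z" by simp
next
  have le: "c * lower_along p y z \<le> lower_along p y (c *\<^sub>R z)" if c: "c > 0" for c z
  proof (rule lower_along_greatest)
    fix t :: real assume t: "t \<ge> 0"
    have "lower_along p y z \<le> p (z + (t / c) *\<^sub>R y) - t / c * p y"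
      by (rule lower_along_le[OF p]) (use c t in simp)
    then have "c * lower_along p y z \<le> c * p (z + (t / c) *\<^sub>R y) - t * p y"
      using c by (simp add: field_simps)
    also have "c * p (z + (t / c) *\<^sub>R y) = p (c *\<^sub>R z + t *\<^sub>R y)"
      using sublinear_scale[OF p, of c "z + (t / c) *\<^sub>R y"] c by (simp add: scaleR_add_right)
    finally show "c * lower_along p y z \<le> p (c *\<^sub>R z + t *\<^sub>R y) - t * p y" .
  qed
  fix c :: real and z assume c: "c > 0"
  have "inverse c * lower_along p y (c *\<^sub>R z) \<le> lower_along p y z"
    using le[of "inverse c" "c *\<^sub>R z"] c by simp
  then have "lower_along p y (c *\<^sub>R z) \<le> c * lower_along p y z"
    using c by (simp add: field_simps)
  with le[OF c, of z] show "lower_along p y (c *\<^sub>R z) = c * lower_along p y z" by simp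
qed

text \<open>A minimal \<open>p\<close> coincides with \<open>lower_along p y\<close> for every
  \<open>y\<close>. The term \<open>t = 1\<close> of that infimum gives \<open>p z \<le> p (z + y) -
  p y\<close>, which is the missing half of additivity.\<close>

lemma minimal_sublinear_linear:
  assumes p: "sublinear p"
    and min: "\<And>q. sublinear q \<Longrightarrow> q \<le> p \<Longrightarrow> q = p"
  shows "linear p"
proof -
  have "lower_along p y \<le> p" for y
    by (rule le_funI) (use lower_along_le[OF p, of 0] in simp)
  with min sublinear_lower_along[OF p] have eq: "lower_along p y = p" for y by blast
  have add: "p (z + y) = p z + p y" for z y
    using lower_along_le[OF p, of 1 y z] sublinear_add[OF p, of z y] by (simp add: eq)
  then have neg: "p (- z) = - p z" for z
    using add[of z "- z"] sublinear_zero[OF p] by simp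
  show ?thesis
  proof (rule linearI)
    show "p (c *\<^sub>R z) = c *\<^sub>R p z" for c z
      using sublinear_scale[OF p, of c z] sublinear_scale[OF p, of "- c" z] neg[of "c *\<^sub>R z"]
      by (cases "c \<ge> 0") auto
  qed (rule add)
qed

text \<open>A minimal sublinear functional below \<open>p\<close> exists and is linear. Zorn's lemma
  applies because the pointwise infimum of a chain of sublinear functionals below \<open>p\<close>
  is again sublinear: it is finite, as \<open>- p (- x)\<close> bounds all values at
  \<open>x\<close> from below, and to compare \<open>q x + r y\<close> with the infimum at \<open>x
  + y\<close> one uses the smaller of \<open>q\<close> and \<open>r\<close>.\<close>

lemma linear_below_sublinear:
  assumes p: "sublinear p"
  obtains f where "linear f" "f \<le> p"
proof -
  let ?A = "{q. sublinear q \<and> q \<le> p}"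
  have "\<exists>m\<in>?A. \<forall>q\<in>?A. m \<ge> q \<longrightarrow> q = m"
  proof (rule predicate_Zorn)
    show "partial_order_on ?A (relation_of (\<lambda>q r. r \<le> q) ?A)"
      by (rule partial_order_on_relation_ofI) (blast intro: order_trans order_antisym)+
  next
    fix C assume C: "C \<in> Chains (relation_of (\<lambda>q r. r \<le> q) ?A)"
    have sub: "sublinear q" and le: "q x \<le> p x" if "q \<in> C" for q x
      using Chains_relation_of[OF C] that by (auto simp: le_fun_def)
    have total: "q \<le> r \<or> r \<le> q" if "q \<in> C" "r \<in> C" for q r
      using C that unfolding Chains_def relation_of_def by blast
    show "\<exists>u\<in>?A. \<forall>q\<in>C. u \<le> q"
    proof (cases "C = {}")
      case True
      then show ?thesis using p by blast
    next
      case False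
      define u where "u x = (INF q\<in>C. q x)" for x
      have lower: "u x \<le> q x" if "q \<in> C" for q x
        unfolding u_def
      proof (rule cINF_lower[OF _ that], rule bdd_belowI2[of _ "- p (- x)"])
        show "- p (- x) \<le> q x" if "q \<in> C" for q
          using sublinear_lower[OF sub[OF that], of x] le[OF that, of "- x"] by simp
      qed
      have greatest: "m \<le> u x" if "\<And>q. q \<in> C \<Longrightarrow> m \<le> q x" for m x
        unfolding u_def using False that by (rule cINF_greatest)
      have "sublinear u"
        unfolding sublinear_def
      proof (intro conjI allI impI)
        fix x y
        have *: "u (x + y) \<le> q x + r y" if qr: "q \<in> C" "r \<in> C" for q r
        proof -
          obtain m where m: "m \<in> C" "m x \<le> q x" "m y \<le> r y"
            using total[OF qr] qr by (auto simp: le_fun_def)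
          then show ?thesis
            using lower[OF m(1), of "x + y"] sublinear_add[OF sub[OF m(1)], of x y] by simp
        qed
        have "u (x + y) - u x \<le> u y"
        proof (rule greatest)
          fix r assume r: "r \<in> C"
          have "u (x + y) - r y \<le> u x"
            by (rule greatest) (use *[OF _ r] in \<open>simp add: algebra_simps\<close>)
          then show "u (x + y) - u x \<le> r y" by simp
        qed
        then show "u (x + y) \<le> u x + u y" by simp
      next
        fix t :: real and x assume t: "t > 0"
        have "u (t *\<^sub>R x) / t \<le> u x"
        proof (rule greatest)
          fix q assume q: "q \<in> C"
          show "u (t *\<^sub>R x) / t \<le> q x"
            using lower[OF q, of "t *\<^sub>R x"] sublinear_scale[OF sub[OF q], of t x] t
            by (simp add: field_simps)
        qed
        moreover have "t * u x \<le> u (t *\<^sub>R x)"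
        proof (rule greatest)
          fix q assume q: "q \<in> C"
          show "t * u x \<le> q (t *\<^sub>R x)"
            using lower[OF q, of x] sublinear_scale[OF sub[OF q], of t x] t by simp
        qed
        ultimately show "u (t *\<^sub>R x) = t * u x" using t by (simp add: field_simps)
      qed
      moreover have "u \<le> p"
        using False lower le by (metis ex_in_conv le_fun_def order_trans)
      ultimately show ?thesis using lower by (auto simp: le_fun_def)
    qed
  qed
  then obtain m where m: "sublinear m" "m \<le> p"
    and min: "\<And>q. sublinear q \<Longrightarrow> q \<le> p \<Longrightarrow> q \<le> m \<Longrightarrow> q = m" by auto
  have "linear m"
    using m(1) by (rule minimal_sublinear_linear) (use m(2) min in \<open>blast intro: order_trans\<close>)
  then show thesis using m(2) that by blast
qed

text \<open>A linear functional below \<open>lower_along norm x\<close> lies below the norm, and is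
  at most \<open>- norm x\<close> at \<open>- x\<close>, hence norms \<open>x\<close>. This is what
  makes weak* slices nonempty.\<close>

lemma norming_functional:
  fixes x :: "'x::real_normed_vector"
  obtains \<phi> :: "'x \<Rightarrow>\<^sub>L real" where "norm \<phi> \<le> 1" "blinfun_apply \<phi> x = norm x"
proof -
  have p: "sublinear (norm :: 'x \<Rightarrow> real)" by (simp add: sublinear_def norm_triangle_ineq)
  obtain f where f: "linear f" "f \<le> lower_along norm x"
    using linear_below_sublinear[OF sublinear_lower_along[OF p]] .
  have below: "f z \<le> norm z" for z
    using le_funD[OF f(2), of z] lower_along_le[OF p, of 0 x z] by simp
  have bound: "norm (f z) \<le> norm z" for z
    using below[of z] below[of "- z"] linear_neg[OF f(1), of z] by simp
  have "f (- x) \<le> - norm x"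
    using le_funD[OF f(2), of "- x"] lower_along_le[OF p, of 1 x "- x"] by simp
  then have fx: "f x = norm x" using below[of x] linear_neg[OF f(1), of x] by simp
  have "bounded_linear f"
    by (rule bounded_linear_intro[where K = 1])
      (use bound linear_add[OF f(1)] linear_scale[OF f(1)] in auto)
  then have app: "blinfun_apply (Blinfun f) = f" by (rule bounded_linear_Blinfun_apply)
  show thesis
  proof (rule that[of "Blinfun f"])
    show "norm (Blinfun f) \<le> 1" by (rule norm_blinfun_bound) (use bound in \<open>simp_all add: app\<close>)
  qed (simp add: app fx)
qed

section \<open>Perturbations of Lipschitz functions near a trapezoid pair\<close>

definition two_bump :: "'a::metric_space \<Rightarrow> 'a \<Rightarrow> real \<Rightarrow> real \<Rightarrow> 'a \<Rightarrow> real" where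
  "two_bump u v s t p = max 0 (s - dist p u) - max 0 (t - dist p v)"

text \<open>The function \<open>f\<close> is constant on the ball of radius \<open>s\<close> around
  \<open>u\<close>, and away from it \<open>f\<close> differs from its value there by at least
  \<open>s\<close> less than a nonexpansive function may; likewise at \<open>v\<close>. This slack
  is exactly what \<open>two_bump u v s t\<close> uses up, as it has height \<open>s\<close> at
  \<open>u\<close> and depth \<open>t\<close> at \<open>v\<close> and vanishes off the two balls.
  Since it does not depend on \<open>f\<close>, one perturbation serves any number of functions at
  the same time.\<close>

lemma two_bump_perturbation:
  assumes st: "s \<ge> 0" "t \<ge> 0" and ab: "\<bar>\<alpha> - \<beta>\<bar> \<le> dist u v - s - t"
    and lip: "\<And>p q. \<bar>f p - f q\<bar> \<le> dist p q"
    and fu: "\<And>q. \<bar>f q - \<alpha>\<bar> \<le> max 0 (dist q u - s)"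
    and fv: "\<And>q. \<bar>f q - \<beta>\<bar> \<le> max 0 (dist q v - t)"
  shows "\<bar>f p - f q\<bar> + \<bar>two_bump u v s t p - two_bump u v s t q\<bar> \<le> dist p q"
proof -
  have tri: "dist u v \<le> dist p u + dist p v" "dist u v \<le> dist q u + dist q v"
    "dist p u \<le> dist p q + dist q u" "dist q u \<le> dist p q + dist p u"
    "dist p v \<le> dist p q + dist q v" "dist q v \<le> dist p q + dist p v"
    by (metis dist_commute dist_triangle)+
  have apart: "dist p u \<ge> s \<or> dist p v \<ge> t" "dist q u \<ge> s \<or> dist q v \<ge> t"
    using tri(1,2) ab by linarith+
  show ?thesis
    using lip[of p q] fu[of p] fu[of q] fv[of p] fv[of q] tri apart ab st
    unfolding two_bump_def max_def by (smt (verit))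
qed

text \<open>McShane's formula in which the two balls act as additional points: the least of the
  functions \<open>h x + dist x q\<close>, \<open>\<alpha> + max 0 (dist q u - s)\<close> and
  \<open>\<beta> + max 0 (dist q v - t)\<close>. The compatibility conditions on \<open>h\<close>,
  \<open>\<alpha>\<close> and \<open>\<beta>\<close> ensure that no prescribed value is undercut by
  another term.\<close>

lemma extension_constant_on_two_balls:
  fixes h :: "'a::metric_space \<Rightarrow> real"
  assumes N: "finite N" "N \<noteq> {}"
    and h: "\<And>x y. x \<in> N \<Longrightarrow> y \<in> N \<Longrightarrow> h x - h y \<le> dist x y"
    and hu: "\<And>x. x \<in> N \<Longrightarrow> \<bar>h x - \<alpha>\<bar> \<le> dist x u - s"
    and hv: "\<And>x. x \<in> N \<Longrightarrow> \<bar>h x - \<beta>\<bar> \<le> dist x v - t"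
    and ab: "\<bar>\<alpha> - \<beta>\<bar> \<le> dist u v - s - t"
  obtains f where "\<And>x. x \<in> N \<Longrightarrow> f x = h x"
    and "\<And>p q. \<bar>f p - f q\<bar> \<le> dist p q"
    and "\<And>q. \<bar>f q - \<alpha>\<bar> \<le> max 0 (dist q u - s)"
    and "\<And>q. \<bar>f q - \<beta>\<bar> \<le> max 0 (dist q v - t)"
proof -
  define m where "m q = Min ((\<lambda>x. h x + dist x q) ` N)" for q
  have m_le: "m q \<le> h x + dist x q" if "x \<in> N" for x q
    unfolding m_def using N that by simp
  have m_ex: "\<exists>x\<in>N. m q = h x + dist x q" for q
  proof -
    have "m q \<in> (\<lambda>x. h x + dist x q) ` N" unfolding m_def using N by (intro Min_in) auto
    then show ?thesis by blast
  qed
  let ?a = "\<lambda>q. \<alpha> + max 0 (dist q u - s)" and ?b = "\<lambda>q. \<beta> + max 0 (dist q v - t)"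
  define f where "f q = min (m q) (min (?a q) (?b q))" for q
  have f_le: "f q \<le> m q" "f q \<le> ?a q" "f q \<le> ?b q" for q
    by (simp_all add: f_def)
  have f_cases: "f q = m q \<or> f q = ?a q \<or> f q = ?b q" for q
    by (auto simp: f_def min_def)
  have tri: "dist p r \<le> dist p q + dist q r" for p q r :: 'a
    by (rule dist_triangle)
  show thesis
  proof (rule that[of f])
    show "f x = h x" if x: "x \<in> N" for x
    proof (rule antisym)
      show "f x \<le> h x" using f_le(1)[of x] m_le[OF x, of x] by simp
      obtain y where y: "y \<in> N" "m x = h y + dist y x" using m_ex by blast
      show "h x \<le> f x"
        using f_cases[of x] y(2) h[OF x y(1)] hu[OF x] hv[OF x] by (auto simp: dist_commute)
    qed
    have one_sided: "f q - f p \<le> dist p q" for p q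
    proof -
      obtain y where y: "y \<in> N" "m p = h y + dist y p" using m_ex by blast
      have "max 0 (dist q w - r) \<le> max 0 (dist p w - r) + dist p q" for w r
        using tri[of q w p] by (simp add: dist_commute max_def)
      from this[of u s] this[of v t] show ?thesis
        using f_cases[of p] y(2) m_le[OF y(1), of q] f_le[of q] tri[of y q p]
        by (elim disjE) linarith+
    qed
    show "\<bar>f p - f q\<bar> \<le> dist p q" for p q
      using one_sided[of p q] one_sided[of q p] by (auto simp: dist_commute)
    show "\<bar>f q - \<alpha>\<bar> \<le> max 0 (dist q u - s)" for q
    proof -
      obtain y where y: "y \<in> N" "m q = h y + dist y q" using m_ex by blast
      show ?thesis
        using f_cases[of q] y(2) f_le(2)[of q] hu[OF y(1)] tri[of y u q] tri[of u v q] ab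
        by (auto simp: dist_commute)
    qed
    show "\<bar>f q - \<beta>\<bar> \<le> max 0 (dist q v - t)" for q
    proof -
      obtain y where y: "y \<in> N" "m q = h y + dist y q" using m_ex by blast
      show ?thesis
        using f_cases[of q] y(2) f_le(3)[of q] hv[OF y(1)] tri[of y v q] tri[of u v q] ab
        by (auto simp: dist_commute)
    qed
  qed
qed

text \<open>Helly's theorem on the line: the intervals \<open>[l x, r x]\<close> intersect in one
  interval, so do the intervals \<open>[l' x, r' x]\<close>, and the two intersections are at
  distance at most \<open>D\<close> when this holds for each pair of end points that face each
  other.\<close>

lemma closest_points_of_two_intervals:
  fixes l r l' r' :: "'b \<Rightarrow> real"
  assumes N: "finite N" "N \<noteq> {}" and D: "D \<ge> 0"
    and lr: "\<And>x y. x \<in> N \<Longrightarrow> y \<in> N \<Longrightarrow> l x \<le> r y"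
    and lr': "\<And>x y. x \<in> N \<Longrightarrow> y \<in> N \<Longrightarrow> l' x \<le> r' y"
    and cross: "\<And>x y. x \<in> N \<Longrightarrow> y \<in> N \<Longrightarrow> l x \<le> r' y + D \<and> l' x \<le> r y + D"
  obtains \<alpha> \<beta> where "\<And>x. x \<in> N \<Longrightarrow> l x \<le> \<alpha> \<and> \<alpha> \<le> r x"
    and "\<And>x. x \<in> N \<Longrightarrow> l' x \<le> \<beta> \<and> \<beta> \<le> r' x" and "\<bar>\<alpha> - \<beta>\<bar> \<le> D"
proof -
  have fin: "finite (k ` N)" "k ` N \<noteq> {}" for k :: "'b \<Rightarrow> real" using N by auto
  define L R L' R' where "L = Max (l ` N)" and "R = Min (r ` N)"
    and "L' = Max (l' ` N)" and "R' = Min (r' ` N)"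
  note defs = L_def R_def L'_def R'_def
  have "\<exists>x\<in>N. L = l x" "\<exists>x\<in>N. R = r x" "\<exists>x\<in>N. L' = l' x" "\<exists>x\<in>N. R' = r' x"
    using Max_in[OF fin, of l] Min_in[OF fin, of r] Max_in[OF fin, of l'] Min_in[OF fin, of r']
    by (auto simp: defs)
  then have "L \<le> R" "L' \<le> R'" "L \<le> R' + D" "L' \<le> R + D"
    using lr lr' cross by (metis (no_types))+
  \<comment> \<open>\<open>\<alpha>\<close> is the point of \<open>[L, R]\<close> nearest to \<open>L'\<close>, and \<open>\<beta>\<close> the point of \<open>[L', R']\<close> nearest to \<open>\<alpha>\<close>.\<close>
  then have "\<exists>\<alpha> \<beta>. L \<le> \<alpha> \<and> \<alpha> \<le> R \<and> L' \<le> \<beta> \<and> \<beta> \<le> R' \<and> \<bar>\<alpha> - \<beta>\<bar> \<le> D"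
    using D by (intro exI[of _ "max L (min R L')"] exI[of _ "max L' (min R' (max L (min R L')))"])
      (auto simp: max_def min_def)
  then obtain \<alpha> \<beta> where *: "L \<le> \<alpha>" "\<alpha> \<le> R" "L' \<le> \<beta>" "\<beta> \<le> R'" "\<bar>\<alpha> - \<beta>\<bar> \<le> D" by blast
  have "l x \<le> L" "R \<le> r x" "l' x \<le> L'" "R' \<le> r' x" if "x \<in> N" for x
    unfolding defs using N that by simp_all
  with * show thesis by (intro that[of \<alpha> \<beta>]) (meson order_trans)+
qed

text \<open>The assumption on quadruples is a sum of two terms, one that only involves
  \<open>u\<close> and one that only involves \<open>v\<close>. So it says that the largest
  admissible radii at \<open>u\<close> and at \<open>v\<close> add up to at least \<open>(1 -
  \<epsilon>) * dist u v\<close>. The radius at \<open>u\<close> is taken as large as possible up to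
  that total, and the radius at \<open>v\<close> makes up the rest.\<close>

lemma trapezoid_radii:
  fixes u v :: "'a::metric_space"
  assumes N: "finite N" "N \<noteq> {}" and \<epsilon>: "0 \<le> \<epsilon>" "\<epsilon> \<le> 1"
    and quad: "\<And>x y z w. x \<in> N \<Longrightarrow> y \<in> N \<Longrightarrow> z \<in> N \<Longrightarrow> w \<in> N \<Longrightarrow>
      (1 - \<epsilon>) * (dist x y + dist z w + 2 * dist u v) \<le> dist x u + dist y u + dist z v + dist w v"
  obtains s t where "s \<ge> 0" "t \<ge> 0" "s + t = (1 - \<epsilon>) * dist u v"
    and "\<And>x y. x \<in> N \<Longrightarrow> y \<in> N \<Longrightarrow> 2 * s \<le> dist x u + dist y u - (1 - \<epsilon>) * dist x y"
    and "\<And>x y. x \<in> N \<Longrightarrow> y \<in> N \<Longrightarrow> 2 * t \<le> dist x v + dist y v - (1 - \<epsilon>) * dist x y"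
proof -
  define k where "k = (\<lambda>(w::'a) (x, y). (dist x w + dist y w - (1 - \<epsilon>) * dist x y) / 2)"
  have fin: "finite (N \<times> N)" "N \<times> N \<noteq> {}" using N by auto
  have k_pos: "k w p \<ge> 0" for w :: 'a and p
  proof -
    obtain x y where p: "p = (x, y)" by (cases p)
    have "(1 - \<epsilon>) * dist x y \<le> 1 * dist x y" by (rule mult_right_mono) (use \<epsilon> in auto)
    then show ?thesis using dist_triangle2[of x y w] by (simp add: k_def p)
  qed
  define s\<^sub>0 where "s\<^sub>0 = Min (k u ` (N \<times> N))"
  define s where "s = min s\<^sub>0 ((1 - \<epsilon>) * dist u v)"
  obtain x\<^sub>0 y\<^sub>0 where s\<^sub>0: "x\<^sub>0 \<in> N" "y\<^sub>0 \<in> N" "s\<^sub>0 = k u (x\<^sub>0, y\<^sub>0)"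
  proof -
    have "s\<^sub>0 \<in> k u ` (N \<times> N)" unfolding s\<^sub>0_def using fin by (intro Min_in) auto
    then show thesis using that by blast
  qed
  have s\<^sub>0_le: "s\<^sub>0 \<le> k u (x, y)" if "x \<in> N" "y \<in> N" for x y
    unfolding s\<^sub>0_def using fin that by (intro Min_le) auto
  have pos: "(1 - \<epsilon>) * dist u v \<ge> 0" using \<epsilon> by simp
  show thesis
  proof (rule that[of s "(1 - \<epsilon>) * dist u v - s"])
    show "s \<ge> 0" using pos k_pos[of u "(x\<^sub>0, y\<^sub>0)"] s\<^sub>0(3) by (simp add: s_def)
    show "(1 - \<epsilon>) * dist u v - s \<ge> 0" by (simp add: s_def)
    show "2 * s \<le> dist x u + dist y u - (1 - \<epsilon>) * dist x y" if "x \<in> N" "y \<in> N" for x y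
      using s\<^sub>0_le[OF that] by (simp add: s_def k_def)
    show "2 * ((1 - \<epsilon>) * dist u v - s) \<le> dist x v + dist y v - (1 - \<epsilon>) * dist x y"
      if "x \<in> N" "y \<in> N" for x y
      using quad[OF s\<^sub>0(1,2) that] s\<^sub>0(3) k_pos[of v "(x, y)"]
      by (simp add: s_def k_def min_def algebra_simps)
  qed simp
qed

text \<open>The values \<open>\<alpha>\<close> and \<open>\<beta>\<close> of \<open>f\<close> on the
  two balls have to lie in certain intervals around the prescribed values on \<open>N\<close>. The
  choice of radii makes each of the two families of intervals intersect; the assumption on pairs
  lets \<open>\<alpha>\<close> and \<open>\<beta>\<close> be chosen at distance at most \<open>dist
  u v - s - t\<close>.\<close>

lemma trapezoid_bump:
  fixes u v :: "'a::metric_space"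
  assumes N: "finite N" "N \<noteq> {}" and \<epsilon>: "0 \<le> \<epsilon>" "\<epsilon> \<le> 1"
    and pair: "\<And>x y. x \<in> N \<Longrightarrow> y \<in> N \<Longrightarrow>
      (1 - \<epsilon>) * (dist x y + dist u v) \<le> dist x u + dist y v"
    and quad: "\<And>x y z w. x \<in> N \<Longrightarrow> y \<in> N \<Longrightarrow> z \<in> N \<Longrightarrow> w \<in> N \<Longrightarrow>
      (1 - \<epsilon>) * (dist x y + dist z w + 2 * dist u v) \<le> dist x u + dist y u + dist z v + dist w v"
  obtains g where "\<And>x. x \<in> N \<Longrightarrow> g x = 0" and "g u - g v = (1 - \<epsilon>) * dist u v"
    and "\<And>h. (\<And>p q. \<bar>h p - h q\<bar> \<le> dist p q) \<Longrightarrow>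
      \<exists>f. (\<forall>x\<in>N. f x = (1 - \<epsilon>) * h x) \<and> (\<forall>p q. \<bar>f p - f q\<bar> + \<bar>g p - g q\<bar> \<le> dist p q)"
proof -
  obtain s t where st: "s \<ge> 0" "t \<ge> 0" "s + t = (1 - \<epsilon>) * dist u v"
    and s: "\<And>x y. x \<in> N \<Longrightarrow> y \<in> N \<Longrightarrow> 2 * s \<le> dist x u + dist y u - (1 - \<epsilon>) * dist x y"
    and t: "\<And>x y. x \<in> N \<Longrightarrow> y \<in> N \<Longrightarrow> 2 * t \<le> dist x v + dist y v - (1 - \<epsilon>) * dist x y"
    using trapezoid_radii[OF N \<epsilon> quad] by blast
  have pair': "(1 - \<epsilon>) * dist x y + (s + t) \<le> dist x u + dist y v" if "x \<in> N" "y \<in> N" for x y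
    using pair[OF that] st(3) by (simp add: distrib_left)
  have shrink: "(1 - \<epsilon>) * dist x y \<le> dist x y" for x y :: 'a
    using \<epsilon> by (simp add: mult_left_le_one_le)
  have D: "dist u v - s - t \<ge> 0" using shrink[of u v] st(3) by linarith
  show thesis
  proof (rule that[of "two_bump u v s t"])
    show "two_bump u v s t x = 0" if "x \<in> N" for x
      using s[OF that that] t[OF that that] by (simp add: two_bump_def)
    show "two_bump u v s t u - two_bump u v s t v = (1 - \<epsilon>) * dist u v"
      using st D by (simp add: two_bump_def dist_commute)
    fix h :: "'a \<Rightarrow> real" assume h: "\<And>p q. \<bar>h p - h q\<bar> \<le> dist p q"
    define k where "k x = (1 - \<epsilon>) * h x" for x
    have k: "k p - k q \<le> (1 - \<epsilon>) * dist p q" for p q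
      using mult_left_mono[OF abs_le_D1[OF h[of p q]], of "1 - \<epsilon>"] \<epsilon>
      by (simp add: k_def right_diff_distrib)
    obtain \<alpha> \<beta> where \<alpha>: "\<And>x. x \<in> N \<Longrightarrow> k x - (dist x u - s) \<le> \<alpha> \<and> \<alpha> \<le> k x + (dist x u - s)"
      and \<beta>: "\<And>x. x \<in> N \<Longrightarrow> k x - (dist x v - t) \<le> \<beta> \<and> \<beta> \<le> k x + (dist x v - t)"
      and \<alpha>\<beta>: "\<bar>\<alpha> - \<beta>\<bar> \<le> dist u v - s - t"
    proof (rule closest_points_of_two_intervals[OF N D])
      fix x y assume xy: "x \<in> N" "y \<in> N"
      show "k x - (dist x u - s) \<le> k y + (dist y u - s)" using s[OF xy] k[of x y] by linarith
      show "k x - (dist x v - t) \<le> k y + (dist y v - t)" using t[OF xy] k[of x y] by linarith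
      show "k x - (dist x u - s) \<le> k y + (dist y v - t) + (dist u v - s - t) \<and>
          k x - (dist x v - t) \<le> k y + (dist y u - s) + (dist u v - s - t)"
        using pair'[OF xy] pair'[OF xy(2,1)] k[of x y] D dist_commute[of x y] by auto
    qed blast
    obtain f where f: "\<And>x. x \<in> N \<Longrightarrow> f x = k x" "\<And>p q. \<bar>f p - f q\<bar> \<le> dist p q"
      "\<And>q. \<bar>f q - \<alpha>\<bar> \<le> max 0 (dist q u - s)" "\<And>q. \<bar>f q - \<beta>\<bar> \<le> max 0 (dist q v - t)"
    proof (rule extension_constant_on_two_balls[OF N _ _ _ \<alpha>\<beta>, of k])
      show "k x - k y \<le> dist x y" for x y using k[of x y] shrink[of x y] by linarith
      show "\<bar>k x - \<alpha>\<bar> \<le> dist x u - s" if "x \<in> N" for x using \<alpha>[OF that] by auto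
      show "\<bar>k x - \<beta>\<bar> \<le> dist x v - t" if "x \<in> N" for x using \<beta>[OF that] by auto
    qed blast
    then show "\<exists>f. (\<forall>x\<in>N. f x = (1 - \<epsilon>) * h x) \<and>
        (\<forall>p q. \<bar>f p - f q\<bar> + \<bar>two_bump u v s t p - two_bump u v s t q\<bar> \<le> dist p q)"
      using two_bump_perturbation[OF st(1,2) \<alpha>\<beta> f(2-4)] by (auto simp: k_def)
  qed
qed

section \<open>Weak* slices of the unit ball of the Lipschitz functions\<close>

lemma lip0_fun_diff: "lip0_fun (f - g) p = lip0_fun f p - lip0_fun g p"
  by (simp only: minus_lip0_def uminus_lip0_def plus_lip0.rep_eq scaleR_lip0.rep_eq)

lemma lip0_unit_ball_iff:
  fixes f :: "'a::pointed_metric_space lip0"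
  shows "norm f \<le> 1 \<longleftrightarrow> (\<forall>p q. \<bar>lip0_fun f p - lip0_fun f q\<bar> \<le> dist p q)"
proof
  assume "norm f \<le> 1"
  then have "norm f * dist p q \<le> dist p q" for p q :: 'a
    by (simp add: mult_left_le_one_le)
  then show "\<forall>p q. \<bar>lip0_fun f p - lip0_fun f q\<bar> \<le> dist p q"
    using order_trans[OF lip0_norm_bound[of f]] by blast
next
  assume "\<forall>p q. \<bar>lip0_fun f p - lip0_fun f q\<bar> \<le> dist p q"
  then show "norm f \<le> 1" by (intro lip0_norm_least) simp_all
qed

lemma lip0_fun_Lip0:
  assumes "\<And>p q. \<bar>f p - f q\<bar> \<le> dist p q" "f base_point = 0"
  shows "lip0_fun (Lip0 f) = f"
proof (rule Lip0_inverse)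
  have "1-lipschitz_on UNIV f" by (rule lipschitz_onI) (use assms(1) in \<open>auto simp: dist_real_def\<close>)
  with assms(2) show "f \<in> {f. (\<exists>L. L-lipschitz_on UNIV f) \<and> f base_point = 0}"
    by (intro CollectI conjI exI)
qed

lemma lip0_functional_near_molecule:
  assumes "norm f \<le> 1"
  shows "\<bar>blinfun_apply (lip0_functional f) x - mol_pairing (lip0_fun f) \<mu>\<bar>
    \<le> norm (x - completion_embed \<mu>)"
proof -
  have "\<bar>blinfun_apply (lip0_functional f) (x - completion_embed \<mu>)\<bar>
      \<le> norm f * norm (x - completion_embed \<mu>)"
    using norm_blinfun[of "lip0_functional f" "x - completion_embed \<mu>"]
    by (simp add: norm_lip0_functional)
  also have "\<dots> \<le> norm (x - completion_embed \<mu>)"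
    using assms by (simp add: mult_left_le_one_le)
  finally show ?thesis by (simp add: blinfun.diff_right lip0_functional_embed)
qed

lemma lipfree_approx:
  assumes "\<delta> > 0"
  obtains \<mu> where "norm (x - completion_embed \<mu>) < \<delta>"
proof -
  have "x \<in> closure (range completion_embed)" by (simp add: closure_range_completion_embed)
  then obtain \<mu> where "dist (completion_embed \<mu>) x < \<delta>"
    unfolding closure_approachable using assms by blast
  then have "norm (x - completion_embed \<mu>) < \<delta>" by (simp only: dist_norm norm_minus_commute)
  then show thesis by (rule that)
qed

lemma lipfree_norming_lip0:
  fixes x :: "'a::pointed_metric_space lipfree"
  obtains h where "norm h \<le> 1" "blinfun_apply (lip0_functional h) x = norm x"
proof -
  obtain \<phi> :: "'a lipfree \<Rightarrow>\<^sub>L real" where \<phi>: "norm \<phi> \<le> 1" "blinfun_apply \<phi> x = norm x"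
    by (rule norming_functional)
  obtain h where h: "\<phi> = lip0_functional h" by (rule surjE[OF surj_lip0_functional])
  show thesis by (rule that[of h]) (use \<phi> in \<open>simp_all add: h norm_lip0_functional\<close>)
qed

text \<open>Each slice contains a function that norms the vector defining it, and this vector is
  nearly supported on finitely many points. Shrinking the norming function by the factor \<open>1 -
  \<delta>\<close> on these points makes room for the perturbation that
  \<open>trapezoid_bump\<close> provides: it vanishes on these points and has almost full slope
  between \<open>u\<close> and \<open>v\<close>.\<close>

lemma strong_long_trapezoid_imp_weak_star_SSD2P:
  assumes sltp: "strong_long_trapezoid (UNIV :: 'a::pointed_metric_space set)"
  shows "weak_star_SSD2P (lip0_functional :: 'a lip0 \<Rightarrow> _)"
  unfolding weak_star_SSD2P_def
proof (intro allI impI)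
  fix n :: nat and S :: "nat \<Rightarrow> 'a lip0 set" and \<epsilon> :: real
  assume "\<forall>i\<in>{1..n}. \<exists>x\<in>sphere 0 1. \<exists>\<alpha>>0. S i = weak_star_slice lip0_functional x \<alpha>"
  then have "\<forall>i\<in>{1..n}. \<exists>x. norm x = 1 \<and> (\<exists>\<alpha>>0. S i = weak_star_slice lip0_functional x \<alpha>)"
    by (simp add: Bex_def)
  from bchoice[OF this] obtain x where x: "\<And>i. i \<in> {1..n} \<Longrightarrow> norm (x i) = 1"
    and "\<forall>i\<in>{1..n}. \<exists>\<alpha>>0. S i = weak_star_slice lip0_functional (x i) \<alpha>" by blast
  from bchoice[OF this(2)] obtain \<alpha> where \<alpha>: "\<And>i. i \<in> {1..n} \<Longrightarrow> \<alpha> i > 0"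
    and S: "\<And>i. i \<in> {1..n} \<Longrightarrow> S i = weak_star_slice lip0_functional (x i) (\<alpha> i)" by blast
  assume \<epsilon>: "\<epsilon> > 0"
  define m where "m = Min (insert \<epsilon> (insert 1 (\<alpha> ` {1..n})))"
  have m: "m > 0" "m \<le> \<epsilon>" "m \<le> 1" "\<And>i. i \<in> {1..n} \<Longrightarrow> m \<le> \<alpha> i"
    unfolding m_def using \<alpha> \<epsilon> by (auto simp del: Min_insert intro!: Min_le)
  define \<delta> where "\<delta> = m / 4"
  have \<delta>: "\<delta> > 0" "\<delta> < \<epsilon>" "\<delta> < 1" and \<delta>\<alpha>: "\<And>i. i \<in> {1..n} \<Longrightarrow> 4 * \<delta> \<le> \<alpha> i"
    using m by (auto simp: \<delta>_def)
  have "\<exists>\<mu>. norm (x i - completion_embed \<mu>) < \<delta>" for i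
    using lipfree_approx[OF \<delta>(1)] by blast
  then obtain \<mu> where \<mu>: "\<And>i. norm (x i - completion_embed (\<mu> i)) < \<delta>" by metis
  have "\<exists>h. norm h \<le> 1 \<and> blinfun_apply (lip0_functional h) (x i) = norm (x i)" for i
    using lipfree_norming_lip0 by blast
  then obtain h where h: "\<And>i. norm (h i) \<le> 1"
    "\<And>i. blinfun_apply (lip0_functional (h i)) (x i) = norm (x i)" by metis
  define N where "N = insert base_point (\<Union>i\<in>{1..n}. {p. mol_fun (\<mu> i) p \<noteq> 0})"
  have N: "finite N" "N \<noteq> {}" unfolding N_def using finite_mol_support by auto
  obtain u v where uv: "u \<noteq> v"
    and pair: "\<And>x y. x \<in> N \<Longrightarrow> y \<in> N \<Longrightarrow>
      (1 - \<delta>) * (dist x y + dist u v) \<le> dist x u + dist y v"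
    and quad: "\<And>x y z w. x \<in> N \<Longrightarrow> y \<in> N \<Longrightarrow> z \<in> N \<Longrightarrow> w \<in> N \<Longrightarrow>
      (1 - \<delta>) * (dist x y + dist z w + 2 * dist u v) \<le> dist x u + dist y u + dist z v + dist w v"
    using sltp[unfolded strong_long_trapezoid_def, rule_format, OF subset_UNIV N(1) \<delta>(1)] by auto
  obtain g where gN: "\<And>x. x \<in> N \<Longrightarrow> g x = 0" and guv: "g u - g v = (1 - \<delta>) * dist u v"
    and ex: "\<And>h. (\<And>p q. \<bar>h p - h q\<bar> \<le> dist p q) \<Longrightarrow>
      \<exists>f. (\<forall>x\<in>N. f x = (1 - \<delta>) * h x) \<and> (\<forall>p q. \<bar>f p - f q\<bar> + \<bar>g p - g q\<bar> \<le> dist p q)"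
    using trapezoid_bump[OF N less_imp_le[OF \<delta>(1)] less_imp_le[OF \<delta>(3)] pair quad] by blast
  have "\<exists>f. (\<forall>x\<in>N. f x = (1 - \<delta>) * lip0_fun (h i) x) \<and>
      (\<forall>p q. \<bar>f p - f q\<bar> + \<bar>g p - g q\<bar> \<le> dist p q)" for i
    using h(1)[of i] by (intro ex) (simp add: lip0_unit_ball_iff)
  then obtain f where fN: "\<And>i x. x \<in> N \<Longrightarrow> f i x = (1 - \<delta>) * lip0_fun (h i) x"
    and fg: "\<And>i p q. \<bar>f i p - f i q\<bar> + \<bar>g p - g q\<bar> \<le> dist p q" by metis
  have base: "base_point \<in> N" by (simp add: N_def)
  have h0: "lip0_fun (h i) base_point = 0" for i using lip0_fun[of "h i"] by simp
  have lip: "\<bar>f i p - f i q\<bar> \<le> dist p q" "\<bar>g p - g q\<bar> \<le> dist p q"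
    "\<bar>(f i p + g p) - (f i q + g q)\<bar> \<le> dist p q"
    "\<bar>(f i p - g p) - (f i q - g q)\<bar> \<le> dist p q" for i p q
    using fg[of i p q] by linarith+
  have F: "lip0_fun (Lip0 (f i)) = f i" for i
    by (rule lip0_fun_Lip0[OF lip(1)]) (simp add: fN[OF base] h0)
  have G: "lip0_fun (Lip0 g) = g"
    by (rule lip0_fun_Lip0[OF lip(2)]) (rule gN[OF base])
  \<comment> \<open>A Lipschitz bound and the values on \<open>N\<close> ensure membership in a slice. This covers the
    function \<open>f i\<close> and its two perturbations at once, as they agree on \<open>N\<close>.\<close>
  have mem: "k \<in> S i" if i: "i \<in> {1..n}" and k1: "norm k \<le> 1"
    and kN: "\<And>x. x \<in> N \<Longrightarrow> lip0_fun k x = (1 - \<delta>) * lip0_fun (h i) x" for k i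
  proof -
    have "lip0_fun k p = (1 - \<delta>) * lip0_fun (h i) p" if "mol_fun (\<mu> i) p \<noteq> 0" for p
      by (rule kN) (use that i in \<open>auto simp: N_def\<close>)
    then have "mol_pairing (lip0_fun k) (\<mu> i) = (1 - \<delta>) * mol_pairing (lip0_fun (h i)) (\<mu> i)"
      unfolding mol_pairing_def sum_distrib_left
      by (intro sum.cong) auto
    moreover have "mol_pairing (lip0_fun (h i)) (\<mu> i) > 1 - \<delta>"
      using lip0_functional_near_molecule[OF h(1), of i "x i" "\<mu> i"] h(2)[of i] x[OF i] \<mu>[of i]
      by linarith
    ultimately have "mol_pairing (lip0_fun k) (\<mu> i) \<ge> (1 - \<delta>) * (1 - \<delta>)"
      using \<delta>(3) by (simp add: mult_left_mono)
    moreover have "(1 - \<delta>) * (1 - \<delta>) \<ge> 1 - 2 * \<delta>" by (simp add: algebra_simps)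
    ultimately have "blinfun_apply (lip0_functional k) (x i) > 1 - \<alpha> i"
      using lip0_functional_near_molecule[OF k1, of "x i" "\<mu> i"] \<mu>[of i] \<delta>\<alpha>[OF i] \<delta>(1) by linarith
    then show ?thesis using k1 by (simp add: S[OF i] weak_star_slice_def)
  qed
  have "Lip0 (f i) \<in> S i \<and> Lip0 (f i) + Lip0 g \<in> S i \<and> Lip0 (f i) - Lip0 g \<in> S i"
    if i: "i \<in> {1..n}" for i
  proof (intro conjI)
    show "Lip0 (f i) \<in> S i"
      by (rule mem[OF i]) (simp_all only: lip0_unit_ball_iff F fN lip simp_thms)
    show "Lip0 (f i) + Lip0 g \<in> S i"
      by (rule mem[OF i])
        (simp_all only: lip0_unit_ball_iff plus_lip0.rep_eq F G fN gN lip simp_thms add_0_right)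
    show "Lip0 (f i) - Lip0 g \<in> S i"
      by (rule mem[OF i])
        (simp_all only: lip0_unit_ball_iff lip0_fun_diff F G fN gN lip simp_thms diff_0_right)
  qed
  moreover have "norm (Lip0 g) \<le> 1" by (simp only: lip0_unit_ball_iff G lip simp_thms)
  moreover have "norm (Lip0 g) > 1 - \<epsilon>"
  proof -
    have "(1 - \<delta>) * dist u v \<le> norm (Lip0 g) * dist u v"
      using lip0_norm_bound[of "Lip0 g" u v] guv by (simp add: G)
    then have "1 - \<delta> \<le> norm (Lip0 g)" using uv by simp
    then show ?thesis using \<delta>(2) by linarith
  qed
  ultimately show "\<exists>f. \<exists>g\<in>cball 0 1.
      (\<forall>i\<in>{1..n}. f i \<in> S i \<and> f i + g \<in> S i \<and> f i - g \<in> S i) \<and> norm g > 1 - \<epsilon>"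
    by (intro exI[of _ "\<lambda>i. Lip0 (f i)"] bexI[of _ "Lip0 g"]) simp_all
qed

section \<open>From the weak* symmetric strong diameter 2 property to octahedrality\<close>

text \<open>Take the slices given by the elements of \<open>E\<close> and let \<open>y\<close>
  almost norm \<open>g\<close>. Testing the norm of \<open>a *\<^sub>R x + y'\<close> with \<open>f
  + g\<close> and that of \<open>b *\<^sub>R x - y'\<close> with \<open>f - g\<close>, the values of
  \<open>f\<close> at \<open>y'\<close> cancel, those of \<open>g\<close> at the summands
  \<open>y'\<close> add up to twice its value at \<open>y\<close>, and \<open>x\<close> contributes
  almost \<open>a + b\<close>.\<close>

lemma weak_star_SSD2P_imp_decomposably_octahedral:
  fixes \<Phi> :: "'z::banach \<Rightarrow> ('x::banach \<Rightarrow>\<^sub>L real)"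
  assumes \<Phi>: "linear \<Phi>" and iso: "\<And>f. norm (\<Phi> f) = norm f"
    and ssd: "weak_star_SSD2P \<Phi>"
  shows "decomposably_octahedral TYPE('x)"
  unfolding decomposably_octahedral_def
proof (intro allI impI)
  fix E :: "'x set" and \<epsilon> :: real
  assume E: "E \<subseteq> sphere 0 1" "finite E" and \<epsilon>: "\<epsilon> > 0"
  define \<delta> where "\<delta> = min \<epsilon> (1/2)"
  have \<delta>: "\<delta> > 0" "\<delta> \<le> \<epsilon>" "\<delta> < 1" using \<epsilon> by (auto simp: \<delta>_def)
  obtain e where e: "bij_betw e {1..card E} E"
    using E(2) ex_bij_betw_nat_finite_1 by blast
  then have e_sphere: "e i \<in> sphere 0 1" if "i \<in> {1..card E}" for i
    using E(1) that bij_betw_imp_surj_on by blast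
  let ?S = "\<lambda>i. weak_star_slice \<Phi> (e i) \<delta>"
  have "\<forall>i\<in>{1..card E}. \<exists>x\<in>sphere 0 1. \<exists>\<alpha>>0. ?S i = weak_star_slice \<Phi> x \<alpha>"
    using e_sphere \<delta>(1) by blast
  from ssd[unfolded weak_star_SSD2P_def, THEN spec, of "card E", THEN spec, of ?S, THEN mp, OF this,
      THEN spec, of \<delta>, THEN mp, OF \<delta>(1)]
  obtain f g where "g \<in> cball 0 1"
    and f: "\<And>i. i \<in> {1..card E} \<Longrightarrow> f i + g \<in> ?S i \<and> f i - g \<in> ?S i"
    and g: "norm g > 1 - \<delta>" by blast
  have "\<exists>F. norm (F + \<Phi> g) \<le> 1 \<and> norm (F - \<Phi> g) \<le> 1 \<and>
      blinfun_apply (F + \<Phi> g) x > 1 - \<delta> \<and> blinfun_apply (F - \<Phi> g) x > 1 - \<delta>"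
    if x: "x \<in> E" for x
  proof -
    obtain i where i: "i \<in> {1..card E}" "x = e i"
      using e x by (metis bij_betw_imp_surj_on imageE)
    have "norm (\<Phi> (f i + g)) \<le> 1 \<and> norm (\<Phi> (f i - g)) \<le> 1 \<and>
        blinfun_apply (\<Phi> (f i + g)) x > 1 - \<delta> \<and> blinfun_apply (\<Phi> (f i - g)) x > 1 - \<delta>"
      using f[OF i(1)] by (simp add: weak_star_slice_def iso i(2))
    then show ?thesis by (auto simp: linear_add[OF \<Phi>] linear_diff[OF \<Phi>])
  qed
  then obtain F where F: "\<And>x. x \<in> E \<Longrightarrow> norm (F x + \<Phi> g) \<le> 1 \<and> norm (F x - \<Phi> g) \<le> 1 \<and>
      blinfun_apply (F x + \<Phi> g) x > 1 - \<delta> \<and> blinfun_apply (F x - \<Phi> g) x > 1 - \<delta>"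
    by metis
  have le_norm: "blinfun_apply \<phi> z \<le> norm z" if "norm \<phi> \<le> 1" for \<phi> :: "'x \<Rightarrow>\<^sub>L real" and z
  proof -
    have "\<bar>blinfun_apply \<phi> z\<bar> \<le> norm \<phi> * norm z" using norm_blinfun[of \<phi> z] by simp
    also have "\<dots> \<le> norm z" using that by (simp add: mult_left_le_one_le)
    finally show ?thesis by simp
  qed
  obtain y where y: "norm y = 1" "blinfun_apply (\<Phi> g) y > 1 - \<delta>"
  proof -
    have "\<exists>z. \<bar>blinfun_apply (\<Phi> g) z\<bar> > (1 - \<delta>) * norm z"
    proof (rule ccontr)
      assume "\<nexists>z. \<bar>blinfun_apply (\<Phi> g) z\<bar> > (1 - \<delta>) * norm z"
      then have "norm (\<Phi> g) \<le> 1 - \<delta>"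
        using \<delta>(3) by (intro norm_blinfun_bound) (auto simp: not_less)
      then show False using g iso by simp
    qed
    then obtain z where z: "\<bar>blinfun_apply (\<Phi> g) z\<bar> > (1 - \<delta>) * norm z" by blast
    then have z0: "norm z > 0" by (cases "z = 0") (auto simp: blinfun.zero_right)
    define c where "c = sgn (blinfun_apply (\<Phi> g) z) / norm z"
    have "sgn (blinfun_apply (\<Phi> g) z) \<noteq> 0"
      using z \<delta>(3) by (auto simp: sgn_zero_iff mult_less_0_iff)
    then have "norm (c *\<^sub>R z) = 1"
      using z0 by (simp add: c_def abs_mult abs_sgn_eq sgn_zero_iff)
    moreover have "blinfun_apply (\<Phi> g) (c *\<^sub>R z) = \<bar>blinfun_apply (\<Phi> g) z\<bar> / norm z"
      by (simp add: c_def blinfun.scaleR_right abs_sgn mult.commute)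
    then have "blinfun_apply (\<Phi> g) (c *\<^sub>R z) > 1 - \<delta>"
      using z z0 by (simp add: less_divide_eq)
    ultimately show thesis by (rule that)
  qed
  show "\<exists>y\<in>sphere (0::'x) 1. \<forall>(n::nat) (ys :: nat \<Rightarrow> 'x) (xs :: nat \<Rightarrow> 'x) a b.
      (\<Sum>i=1..n. ys i) = y \<longrightarrow> (\<forall>i\<in>{1..n}. xs i \<in> E \<and> a i \<ge> 0 \<and> b i \<ge> 0) \<longrightarrow>
      (\<Sum>i=1..n. norm (a i *\<^sub>R xs i + ys i) + norm (b i *\<^sub>R xs i - ys i))
        \<ge> (1 - \<epsilon>) * ((\<Sum>i=1..n. a i + b i) + 2)"
  proof (intro bexI allI impI)
    fix n :: nat and ys xs :: "nat \<Rightarrow> 'x" and a b :: "nat \<Rightarrow> real"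
    assume sum: "(\<Sum>i=1..n. ys i) = y" and all: "\<forall>i\<in>{1..n}. xs i \<in> E \<and> a i \<ge> 0 \<and> b i \<ge> 0"
    let ?g = "blinfun_apply (\<Phi> g)"
    have "(1 - \<epsilon>) * ((\<Sum>i=1..n. a i + b i) + 2) \<le> (1 - \<delta>) * ((\<Sum>i=1..n. a i + b i) + 2)"
      using \<delta>(2) all by (intro mult_right_mono add_nonneg_nonneg sum_nonneg) auto
    also have "\<dots> \<le> (\<Sum>i=1..n. (1 - \<delta>) * (a i + b i)) + 2 * ?g y"
      using y(2) by (simp add: distrib_left sum_distrib_left)
    also have "?g y = (\<Sum>i=1..n. ?g (ys i))"
      by (simp add: sum[symmetric] blinfun.sum_right)
    also have "(\<Sum>i=1..n. (1 - \<delta>) * (a i + b i)) + 2 * (\<Sum>i=1..n. ?g (ys i)) =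
        (\<Sum>i=1..n. (1 - \<delta>) * (a i + b i) + 2 * ?g (ys i))"
      by (simp add: sum.distrib sum_distrib_left)
    also have "\<dots> \<le> (\<Sum>i=1..n. norm (a i *\<^sub>R xs i + ys i) + norm (b i *\<^sub>R xs i - ys i))"
    proof (rule sum_mono)
      fix i assume "i \<in> {1..n}"
      then have xs: "xs i \<in> E" and ab: "a i \<ge> 0" "b i \<ge> 0" using all by auto
      let ?p = "blinfun_apply (F (xs i) + \<Phi> g)" and ?m = "blinfun_apply (F (xs i) - \<Phi> g)"
      note F' = F[OF xs]
      have "(1 - \<delta>) * (a i + b i) + 2 * ?g (ys i) \<le> a i * ?p (xs i) + b i * ?m (xs i) + 2 * ?g (ys i)"
        using mult_left_mono[OF less_imp_le ab(1), of "1 - \<delta>" "?p (xs i)"]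
          mult_left_mono[OF less_imp_le ab(2), of "1 - \<delta>" "?m (xs i)"] F'
        by (simp add: algebra_simps)
      also have "\<dots> = ?p (a i *\<^sub>R xs i + ys i) + ?m (b i *\<^sub>R xs i - ys i)"
        by (simp add: blinfun.bilinear_simps algebra_simps)
      also have "\<dots> \<le> norm (a i *\<^sub>R xs i + ys i) + norm (b i *\<^sub>R xs i - ys i)"
        using F' by (intro add_mono le_norm) auto
      finally show "(1 - \<delta>) * (a i + b i) + 2 * ?g (ys i)
          \<le> norm (a i *\<^sub>R xs i + ys i) + norm (b i *\<^sub>R xs i - ys i)" .
    qed
    finally show "(\<Sum>i=1..n. norm (a i *\<^sub>R xs i + ys i) + norm (b i *\<^sub>R xs i - ys i))
        \<ge> (1 - \<epsilon>) * ((\<Sum>i=1..n. a i + b i) + 2)" .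
  qed (use y in simp)
qed

section \<open>Decompositions of a vector and their costs\<close>

text \<open>The decompositions of \<open>z\<close> that occur in decomposable octahedrality,
  recorded only through the two numbers that matter: \<open>A\<close> is the sum of all coefficients
  \<open>a\<^sub>i + b\<^sub>i\<close>, and \<open>C\<close> is the sum of all the norms.
  Octahedrality says that \<open>C \<ge> (1 - \<epsilon>) * (A + 2)\<close> for a suitable unit
  vector \<open>z\<close>. The triples \<open>(z, A, C)\<close> form a convex cone, so
  decompositions can be assembled from pieces.\<close>

inductive decomposition_cost ::
    "'x::real_normed_vector set \<Rightarrow> 'x \<Rightarrow> real \<Rightarrow> real \<Rightarrow> bool" for E where
  zero: "decomposition_cost E 0 0 0"
| step: "decomposition_cost E z A C \<Longrightarrow> x \<in> E \<Longrightarrow> a \<ge> 0 \<Longrightarrow> b \<ge> 0 \<Longrightarrow>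
    decomposition_cost E (z + w) (A + (a + b)) (C + (norm (a *\<^sub>R x + w) + norm (b *\<^sub>R x - w)))"

lemma decomposition_cost_sum:
  assumes "decomposition_cost E z A C"
  shows "\<exists>(n::nat) ys xs a b. (\<Sum>i=1..n. ys i) = z \<and>
    (\<forall>i\<in>{1..n}. xs i \<in> E \<and> a i \<ge> 0 \<and> b i \<ge> 0) \<and> (\<Sum>i=1..n. a i + b i) = A \<and>
    (\<Sum>i=1..n. norm (a i *\<^sub>R xs i + ys i) + norm (b i *\<^sub>R xs i - ys i)) = C"
  using assms
proof induction
  case zero
  show ?case by (intro exI[of _ 0]) simp
next
  case (step z A C x a' b' w)
  then obtain n :: nat and ys xs a b where *: "(\<Sum>i=1..n. ys i) = z"
    "\<forall>i\<in>{1..n}. xs i \<in> E \<and> a i \<ge> 0 \<and> b i \<ge> 0" "(\<Sum>i=1..n. a i + b i) = A"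
    "(\<Sum>i=1..n. norm (a i *\<^sub>R xs i + ys i) + norm (b i *\<^sub>R xs i - ys i)) = C" by blast
  have **: "(\<Sum>i=1..n. (ys(Suc n := w)) i) = z"
    "(\<Sum>i=1..n. (a(Suc n := a')) i + (b(Suc n := b')) i) = A"
    "(\<Sum>i=1..n. norm ((a(Suc n := a')) i *\<^sub>R (xs(Suc n := x)) i + (ys(Suc n := w)) i) +
      norm ((b(Suc n := b')) i *\<^sub>R (xs(Suc n := x)) i - (ys(Suc n := w)) i)) = C"
    unfolding *(1,3,4)[symmetric] by (rule sum.cong; simp)+
  show ?case
  proof (intro exI conjI)
    show "(\<Sum>i=1..Suc n. (ys(Suc n := w)) i) = z + w"
      using **(1) by (simp del: fun_upd_apply add: fun_upd_same)
    show "\<forall>i\<in>{1..Suc n}. (xs(Suc n := x)) i \<in> E \<and> (a(Suc n := a')) i \<ge> 0 \<and> (b(Suc n := b')) i \<ge> 0"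
      using *(2) step.hyps by (auto simp: le_Suc_eq)
    show "(\<Sum>i=1..Suc n. (a(Suc n := a')) i + (b(Suc n := b')) i) = A + (a' + b')"
      using **(2) by (simp del: fun_upd_apply add: fun_upd_same)
    show "(\<Sum>i=1..Suc n. norm ((a(Suc n := a')) i *\<^sub>R (xs(Suc n := x)) i + (ys(Suc n := w)) i) +
        norm ((b(Suc n := b')) i *\<^sub>R (xs(Suc n := x)) i - (ys(Suc n := w)) i)) =
      C + (norm (a' *\<^sub>R x + w) + norm (b' *\<^sub>R x - w))"
      using **(3) by (simp del: fun_upd_apply add: fun_upd_same)
  qed
qed

lemma decomposition_cost_add:
  assumes "decomposition_cost E z A C" "decomposition_cost E z' A' C'"
  shows "decomposition_cost E (z + z') (A + A') (C + C')"
  using assms(2)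
proof induction
  case zero
  show ?case using assms(1) by simp
next
  case (step z' A' C' x a b w)
  from decomposition_cost.step[OF step.IH step.hyps(2-4), of w] show ?case
    by (simp only: add.assoc)
qed

lemma decomposition_cost_scale:
  assumes "decomposition_cost E z A C" "c \<ge> 0"
  shows "decomposition_cost E (c *\<^sub>R z) (c * A) (c * C)"
  using assms(1)
proof induction
  case zero
  show ?case using decomposition_cost.zero by simp
next
  case (step z A C x a b w)
  have "norm ((c * a) *\<^sub>R x + c *\<^sub>R w) = c * norm (a *\<^sub>R x + w)"
    "norm ((c * b) *\<^sub>R x - c *\<^sub>R w) = c * norm (b *\<^sub>R x - w)"
    using assms(2) norm_scaleR[of c "a *\<^sub>R x + w"] norm_scaleR[of c "b *\<^sub>R x - w"]
    by (simp_all add: scaleR_add_right scaleR_diff_right)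
  then show ?case
    using decomposition_cost.step[OF step.IH step.hyps(2), of "c * a" "c * b" "c *\<^sub>R w"]
      step.hyps(3,4) assms(2)
    by (simp add: distrib_left scaleR_add_right)
qed

lemma decomposition_cost_single:
  assumes "x \<in> E" "a \<ge> 0" "b \<ge> 0"
  shows "decomposition_cost E w (a + b) (norm (a *\<^sub>R x + w) + norm (b *\<^sub>R x - w))"
  using decomposition_cost.step[OF decomposition_cost.zero assms, of w] by simp

lemma decomposition_cost_nonneg: "decomposition_cost E z A C \<Longrightarrow> A \<ge> 0"
  by (induction rule: decomposition_cost.induct) auto

section \<open>Decompositions in the Lipschitz-free space\<close>

text \<open>With \<open>\<delta>\<^bsub>p\<^esub> - \<delta>\<^bsub>base_point\<^esub>\<close> in
  place of \<open>\<delta>\<^bsub>p\<^esub>\<close>, the differences of point masses are honest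
  differences of vectors of the Lipschitz-free space, and \<open>point_mass\<close> is an isometric
  embedding of \<open>M\<close>.\<close>

definition point_mass :: "'a::pointed_metric_space \<Rightarrow> 'a lipfree" where
  "point_mass p = completion_embed (elem_mol p base_point)"

lemma elem_mol_eq_point_mass: "completion_embed (elem_mol p q) = point_mass p - point_mass q"
proof -
  have "elem_mol p base_point = elem_mol p q + elem_mol q base_point"
    by (rule mol_fun_inject[THEN iffD1])
      (auto simp: plus_molecule.rep_eq mol_fun_elem_mol mol_comb_def)
  then show ?thesis by (simp add: point_mass_def completion_embed_add)
qed

lemma norm_point_mass_diff: "norm (point_mass p - point_mass q) = dist p q"
proof -
  have "1-lipschitz_on UNIV (\<lambda>x. dist x q)"
  proof (rule lipschitz_onI)
    show "dist (dist x q) (dist y q) \<le> 1 * dist x y" for x y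
      using dist_triangle[of x q y] dist_triangle[of y q x] by (simp add: dist_real_def dist_commute abs_le_iff)
  qed simp
  from mol_pairing_norm[OF this, of "elem_mol p q"] norm_elem_mol_le[of p q]
  have "norm (elem_mol p q) = dist p q" by (simp add: mol_pairing_elem_mol)
  then show ?thesis by (simp flip: elem_mol_eq_point_mass)
qed

lemma molecule_point_mass:
  assumes "mol_fun \<mu> = mol_comb ts"
  shows "completion_embed \<mu> = (\<Sum>(c, p, q)\<leftarrow>ts. c *\<^sub>R (point_mass p - point_mass q))"
  using assms
proof (induction ts arbitrary: \<mu>)
  case Nil
  then have "\<mu> = 0"
    by (intro mol_fun_inject[THEN iffD1]) (auto simp: zero_molecule.rep_eq mol_comb_def)
  then show ?case by (simp add: linear_0[OF linear_completion_embed])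
next
  case (Cons t ts)
  obtain c p q where t: "t = (c, p, q)" by (cases t)
  define \<nu> where "\<nu> = Molecule (mol_comb ts)"
  have \<nu>: "mol_fun \<nu> = mol_comb ts" unfolding \<nu>_def by (rule Molecule_inverse) blast
  have "\<mu> = c *\<^sub>R elem_mol p q + \<nu>"
    by (rule mol_fun_inject[THEN iffD1])
      (auto simp: Cons.prems t plus_molecule.rep_eq scaleR_molecule.rep_eq \<nu> mol_fun_elem_mol
        mol_comb_def)
  with Cons.IH[OF \<nu>] show ?case
    by (simp add: t completion_embed_add completion_embed_scaleR elem_mol_eq_point_mass)
qed

definition unit_molecules :: "'a::pointed_metric_space set \<Rightarrow> 'a lipfree set" where
  "unit_molecules N = {(point_mass x - point_mass y) /\<^sub>R dist x y | x y. x \<in> N \<and> y \<in> N \<and> x \<noteq> y}"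

lemma unit_molecules_sphere: "unit_molecules N \<subseteq> sphere 0 1"
  by (auto simp: unit_molecules_def norm_point_mass_diff)

lemma finite_unit_molecules:
  assumes "finite N" shows "finite (unit_molecules N)"
proof (rule finite_subset)
  show "unit_molecules N \<subseteq> (\<lambda>(x, y). (point_mass x - point_mass y) /\<^sub>R dist x y) ` (N \<times> N)"
    by (auto simp: unit_molecules_def)
qed (use assms in simp)

text \<open>The coefficients are taken relative to \<open>point_mass x - point_mass y\<close> rather
  than to the unit vector, so that the degenerate case \<open>x = y\<close> is included: there the
  zero coefficients are attached to an arbitrary element.\<close>

lemma decomposition_cost_point_masses:
  fixes w :: "'a::pointed_metric_space lipfree"
  assumes xy: "x \<in> N" "y \<in> N" and ab: "a \<ge> 0" "b \<ge> 0" and ne: "unit_molecules N \<noteq> {}"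
  shows "decomposition_cost (unit_molecules N) w ((a + b) * dist x y)
    (norm (a *\<^sub>R (point_mass x - point_mass y) + w) + norm (b *\<^sub>R (point_mass x - point_mass y) - w))"
proof (cases "x = y")
  case True
  obtain e where "e \<in> unit_molecules N" using ne by blast
  from decomposition_cost_single[OF this, of 0 0 w] True show ?thesis by simp
next
  case False
  then have "(point_mass x - point_mass y) /\<^sub>R dist x y \<in> unit_molecules N"
    using xy by (auto simp: unit_molecules_def)
  from decomposition_cost_single[OF this, of "a * dist x y" "b * dist x y" w]
  have "decomposition_cost (unit_molecules N) w (a * dist x y + b * dist x y)
      (norm ((a * dist x y) *\<^sub>R ((point_mass x - point_mass y) /\<^sub>R dist x y) + w) +
        norm ((b * dist x y) *\<^sub>R ((point_mass x - point_mass y) /\<^sub>R dist x y) - w))"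
    using ab by simp
  moreover have "(c * dist x y) *\<^sub>R ((point_mass x - point_mass y) /\<^sub>R dist x y) =
      c *\<^sub>R (point_mass x - point_mass y)" for c
    using False by (simp only: scaleR_scaleR mult.assoc right_inverse dist_eq_0_iff not_False_eq_True mult_1_right)
  ultimately show ?thesis by (simp only: distrib_right)
qed

text \<open>One summand suffices: the term for \<open>- w\<close> with coefficient \<open>dist x
  y\<close> regroups into a sum of a molecule from \<open>x\<close> to \<open>u\<close> and one from
  \<open>v\<close> to \<open>y\<close>, which is cheap because the trapezoid is violated.\<close>

lemma decomposition_cost_bad_pair:
  fixes u v :: "'a::pointed_metric_space"
  assumes xy: "x \<in> N" "y \<in> N" and ne: "unit_molecules N \<noteq> {}" and \<epsilon>: "0 \<le> \<epsilon>"
    and bad: "dist x u + dist y v < (1 - \<epsilon>) * (dist x y + dist u v)"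
  obtains A C where "decomposition_cost (unit_molecules N) (point_mass u - point_mass v) A C"
    and "C \<le> (1 - \<epsilon> / 2) * (A + 2 * dist u v)"
proof -
  let ?C = "norm (point_mass u - point_mass v)
    + norm ((point_mass x - point_mass y) - (point_mass u - point_mass v))"
  have cost: "decomposition_cost (unit_molecules N) (point_mass u - point_mass v) (dist x y) ?C"
    using decomposition_cost_point_masses[OF xy order_refl zero_le_one ne,
        of "point_mass u - point_mass v"] by simp
  have "(point_mass x - point_mass y) - (point_mass u - point_mass v) =
      (point_mass x - point_mass u) - (point_mass y - point_mass v)" by simp
  then have "norm ((point_mass x - point_mass y) - (point_mass u - point_mass v))
      \<le> dist x u + dist y v"
    using norm_triangle_ineq4[of "point_mass x - point_mass u" "point_mass y - point_mass v"]
    by (simp only: norm_point_mass_diff)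
  then have "?C \<le> dist u v + (1 - \<epsilon>) * (dist x y + dist u v)"
    using bad by (simp add: norm_point_mass_diff)
  also have "\<dots> \<le> (1 - \<epsilon> / 2) * (dist x y + 2 * dist u v)"
    using \<epsilon> by (simp add: algebra_simps)
  finally show thesis by (rule that[OF cost])
qed

text \<open>The vector \<open>point_mass u - point_mass v\<close> is routed through the midpoint of
  the point masses at \<open>x\<close> and \<open>y\<close> and the midpoint of those at
  \<open>z\<close> and \<open>w\<close>. The two outer parts cost exactly the four distances to
  \<open>u\<close> and \<open>v\<close>. The part between the midpoints is made of molecules of
  \<open>N\<close>, so that its cost equals its coefficient and does not spoil the inequality. By
  the triangle inequality this cost is at most \<open>dist x y + dist z w + 2 * dist u v\<close>, so
  it halves the relative gain at worst; hence \<open>\<epsilon> / 2\<close> in the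
  conclusion.\<close>

lemma decomposition_cost_bad_quadruple:
  fixes u v :: "'a::pointed_metric_space"
  assumes N: "x \<in> N" "y \<in> N" "z \<in> N" "w \<in> N" and ne: "unit_molecules N \<noteq> {}"
    and \<epsilon>: "0 \<le> \<epsilon>" "\<epsilon> \<le> 1"
    and bad: "dist x u + dist y u + dist z v + dist w v
      < (1 - \<epsilon>) * (dist x y + dist z w + 2 * dist u v)"
  obtains A C where "decomposition_cost (unit_molecules N) (point_mass u - point_mass v) A C"
    and "C \<le> (1 - \<epsilon> / 2) * (A + 2 * dist u v)"
proof -
  let ?cost = "decomposition_cost (unit_molecules N)" and ?d = "point_mass :: 'a \<Rightarrow> _"
  \<comment> \<open>With \<open>m\<close> the midpoint of the point masses at \<open>x\<close> and \<open>y\<close>, half of their difference equals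
    both \<open>?d x - m\<close> and \<open>m - ?d y\<close>. So adding or subtracting \<open>?d p - m\<close> leaves a difference of two
    point masses, whose norm is a distance.\<close>
  have centred: "?cost (?d p - (1/2) *\<^sub>R (?d x + ?d y)) (dist x y) (dist x p + dist y p)"
    "?cost ((1/2) *\<^sub>R (?d x + ?d y) - ?d p) (dist x y) (dist x p + dist y p)"
    if "x \<in> N" "y \<in> N" for x y p
  proof -
    define m where "m = (1/2) *\<^sub>R (?d x + ?d y)"
    have half: "(1/2) *\<^sub>R (?d x - ?d y) = ?d x - m" "(1/2) *\<^sub>R (?d x - ?d y) = m - ?d y"
      by (simp_all add: m_def algebra_simps flip: scaleR_add_left)
    have 1: "(1/2) *\<^sub>R (?d x - ?d y) + (?d p - m) = ?d p - ?d y" unfolding half(2) by simp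
    have 3: "(1/2) *\<^sub>R (?d x - ?d y) + (m - ?d p) = ?d x - ?d p" unfolding half(1) by simp
    have 2: "(1/2) *\<^sub>R (?d x - ?d y) - (?d p - m) = ?d x - ?d p"
      "(1/2) *\<^sub>R (?d x - ?d y) - (m - ?d p) = ?d p - ?d y"
      using 1 3 by (metis diff_minus_eq_add minus_diff_eq)+
    have "?cost (?d p - m) ((1/2 + 1/2) * dist x y)
        (norm ((1/2) *\<^sub>R (?d x - ?d y) + (?d p - m)) + norm ((1/2) *\<^sub>R (?d x - ?d y) - (?d p - m)))"
      "?cost (m - ?d p) ((1/2 + 1/2) * dist x y)
        (norm ((1/2) *\<^sub>R (?d x - ?d y) + (m - ?d p)) + norm ((1/2) *\<^sub>R (?d x - ?d y) - (m - ?d p)))"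
      by (rule decomposition_cost_point_masses[OF that _ _ ne]; simp)+
    then have "?cost (?d p - m) (dist x y) (dist x p + dist y p)"
      "?cost (m - ?d p) (dist x y) (dist x p + dist y p)"
      unfolding 1 3 2 norm_point_mass_diff by (simp_all add: dist_commute add.commute)
    then show "?cost (?d p - (1/2) *\<^sub>R (?d x + ?d y)) (dist x y) (dist x p + dist y p)"
      "?cost ((1/2) *\<^sub>R (?d x + ?d y) - ?d p) (dist x y) (dist x p + dist y p)"
      by (simp_all only: m_def)
  qed
  \<comment> \<open>A multiple of a unit molecule of \<open>N\<close> is cancelled by the term with coefficient \<open>b\<close>, so that only
    the other norm remains, which equals that coefficient.\<close>
  have own: "?cost ((1/2) *\<^sub>R (?d x - ?d y)) (dist x y / 2) (dist x y / 2)" if "x \<in> N" "y \<in> N" for x y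
    using decomposition_cost_point_masses[OF that _ _ ne, of 0 "1/2" "(1/2) *\<^sub>R (?d x - ?d y)"]
    by (simp add: norm_point_mass_diff)
  define r where "r = dist x z / 2 + dist y w / 2"
  define T where "T = dist x y + dist z w + 2 * dist u v"
  have "?cost ((?d u - (1/2) *\<^sub>R (?d x + ?d y)) + ((1/2) *\<^sub>R (?d z + ?d w) - ?d v)
        + ((1/2) *\<^sub>R (?d x - ?d z) + (1/2) *\<^sub>R (?d y - ?d w)))
      (dist x y + dist z w + (dist x z / 2 + dist y w / 2))
      (dist x u + dist y u + (dist z v + dist w v) + (dist x z / 2 + dist y w / 2))"
    by (intro decomposition_cost_add centred own N)
  moreover have "(?d u - (1/2) *\<^sub>R (?d x + ?d y)) + ((1/2) *\<^sub>R (?d z + ?d w) - ?d v)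
        + ((1/2) *\<^sub>R (?d x - ?d z) + (1/2) *\<^sub>R (?d y - ?d w)) = ?d u - ?d v"
    by (simp add: algebra_simps)
  ultimately have cost: "?cost (?d u - ?d v) (dist x y + dist z w + r)
      (dist x u + dist y u + (dist z v + dist w v) + r)"
    by (simp only: r_def)
  have "dist x z \<le> dist x u + dist u v + dist z v" "dist y w \<le> dist y u + dist u v + dist w v"
    using dist_triangle[of x z u] dist_triangle[of u z v] dist_triangle[of y w u]
      dist_triangle[of u w v] by (simp_all add: dist_commute)
  moreover have "(1 - \<epsilon>) * T \<le> T" using \<epsilon> by (intro mult_left_le_one_le) (auto simp: T_def)
  ultimately have "r \<le> T"
    using bad zero_le_dist[of x y] zero_le_dist[of z w] unfolding r_def T_def by argo
  then have "\<epsilon> * r \<le> \<epsilon> * T" using \<epsilon> by (intro mult_left_mono)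
  have "dist x u + dist y u + (dist z v + dist w v) + r \<le> (1 - \<epsilon>) * T + r"
    using bad by (simp add: T_def)
  also have "\<dots> \<le> (1 - \<epsilon> / 2) * (T + r)" using \<open>\<epsilon> * r \<le> \<epsilon> * T\<close> by (simp add: algebra_simps)
  finally show thesis by (intro that[OF cost]) (simp add: T_def algebra_simps)
qed

text \<open>A negative coefficient only exchanges the roles of the two points. This is why cheap
  decompositions are asked for all pairs \<open>u \<noteq> v\<close>, in both orders.\<close>

lemma decomposition_cost_sum_list:
  fixes ts :: "(real \<times> 'a::pointed_metric_space \<times> 'a) list"
  assumes bad: "\<And>u v :: 'a. u \<noteq> v \<Longrightarrow>
      \<exists>A C. decomposition_cost E (point_mass u - point_mass v) A C \<and> C \<le> \<kappa> * (A + 2 * dist u v)"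
  shows "\<exists>A C. decomposition_cost E (\<Sum>(c, p, q)\<leftarrow>ts. c *\<^sub>R (point_mass p - point_mass q)) A C \<and>
    C \<le> \<kappa> * (A + 2 * mol_cost ts)"
proof (induction ts)
  case Nil
  show ?case by (intro exI[of _ 0]) (simp add: mol_cost_def decomposition_cost.zero)
next
  case (Cons t ts)
  obtain c p q where t: "t = (c, p, q)" by (cases t)
  obtain A C where AC: "decomposition_cost E (\<Sum>(c, p, q)\<leftarrow>ts. c *\<^sub>R (point_mass p - point_mass q)) A C"
    "C \<le> \<kappa> * (A + 2 * mol_cost ts)" using Cons by blast
  have signed: "\<exists>u v. c *\<^sub>R (point_mass p - point_mass q) = \<bar>c\<bar> *\<^sub>R (point_mass u - point_mass v) \<and>
      dist u v = dist p q"
  proof (cases "c \<ge> 0")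
    case True
    then show ?thesis by auto
  next
    case False
    then show ?thesis
      by (intro exI[of _ q] exI[of _ p]) (simp add: dist_commute scaleR_diff_right)
  qed
  then obtain u v where uv: "c *\<^sub>R (point_mass p - point_mass q) = \<bar>c\<bar> *\<^sub>R (point_mass u - point_mass v)"
    "dist u v = dist p q" by blast
  have "\<exists>A C. decomposition_cost E (point_mass u - point_mass v) A C \<and> C \<le> \<kappa> * (A + 2 * dist u v)"
  proof (cases "u = v")
    case True
    then show ?thesis by (intro exI[of _ 0]) (simp add: decomposition_cost.zero)
  qed (rule bad)
  then obtain A' C' where AC': "decomposition_cost E (point_mass u - point_mass v) A' C'"
    "C' \<le> \<kappa> * (A' + 2 * dist u v)" by blast
  have "decomposition_cost E (\<bar>c\<bar> *\<^sub>R (point_mass u - point_mass v)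
      + (\<Sum>(c, p, q)\<leftarrow>ts. c *\<^sub>R (point_mass p - point_mass q))) (\<bar>c\<bar> * A' + A) (\<bar>c\<bar> * C' + C)"
    by (intro decomposition_cost_add decomposition_cost_scale AC AC') simp
  moreover have "\<bar>c\<bar> * C' + C \<le> \<kappa> * ((\<bar>c\<bar> * A' + A) + 2 * mol_cost (t # ts))"
    using mult_left_mono[OF AC'(2), of "\<bar>c\<bar>"] AC(2) uv(2)
    by (simp add: t mol_cost_def algebra_simps)
  ultimately show ?case by (intro exI conjI) (simp_all add: t uv(1))
qed

lemma lipfree_approx_cost:
  fixes y :: "'a::pointed_metric_space lipfree"
  assumes "\<delta> > 0"
  obtains ts where "norm (y - (\<Sum>(c, p, q)\<leftarrow>ts. c *\<^sub>R (point_mass p - point_mass q))) < \<delta>"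
    and "mol_cost ts < norm y + 2 * \<delta>"
proof -
  obtain \<mu> where \<mu>: "norm (y - completion_embed \<mu>) < \<delta>" using lipfree_approx[OF assms] .
  have "\<exists>ts. mol_fun \<mu> = mol_comb ts \<and> mol_cost ts < norm \<mu> + \<delta>"
  proof (rule ccontr)
    assume "\<nexists>ts. mol_fun \<mu> = mol_comb ts \<and> mol_cost ts < norm \<mu> + \<delta>"
    then have "norm \<mu> + \<delta> \<le> norm \<mu>" by (intro norm_molecule_ge) (auto simp: not_less)
    then show False using assms by simp
  qed
  then obtain ts where ts: "mol_fun \<mu> = mol_comb ts" "mol_cost ts < norm \<mu> + \<delta>" by blast
  have "norm \<mu> \<le> norm y + norm (y - completion_embed \<mu>)"
    using norm_triangle_sub[of "completion_embed \<mu>" y] by (simp add: norm_minus_commute)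
  then show thesis using that[of ts] \<mu> ts by (simp add: molecule_point_mass)
qed

text \<open>Suppose that every pair \<open>u \<noteq> v\<close> violates one of the two trapezoid
  inequalities for \<open>N\<close>. Then every molecule has a cheap decomposition over the unit
  molecules of \<open>N\<close>, and so has, up to a small error, the vector \<open>y\<close> given
  by octahedrality; this contradicts the choice of \<open>y\<close>. Two distinct points are added
  to \<open>N\<close> so that it carries a unit molecule.\<close>

lemma decomposably_octahedral_imp_strong_long_trapezoid:
  assumes doh: "decomposably_octahedral TYPE('a::pointed_metric_space lipfree)"
    and two: "\<exists>x y :: 'a. x \<noteq> y"
  shows "strong_long_trapezoid (UNIV :: 'a set)"
  unfolding strong_long_trapezoid_def
proof (intro allI impI)
  fix N\<^sub>0 :: "'a set" and \<epsilon>\<^sub>0 :: real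
  assume N\<^sub>0: "finite N\<^sub>0" and \<epsilon>\<^sub>0: "\<epsilon>\<^sub>0 > 0"
  obtain x\<^sub>0 y\<^sub>0 :: 'a where xy0: "x\<^sub>0 \<noteq> y\<^sub>0" using two by blast
  define N where "N = insert x\<^sub>0 (insert y\<^sub>0 N\<^sub>0)"
  define \<epsilon> where "\<epsilon> = min \<epsilon>\<^sub>0 1"
  have \<epsilon>: "\<epsilon> > 0" "\<epsilon> \<le> 1" "\<epsilon> \<le> \<epsilon>\<^sub>0" using \<epsilon>\<^sub>0 by (auto simp: \<epsilon>_def)
  let ?E = "unit_molecules N"
  have ne: "?E \<noteq> {}" using xy0 by (auto simp: unit_molecules_def N_def)
  have "\<exists>u v. u \<noteq> v \<and>
      (\<forall>x\<in>N. \<forall>y\<in>N. (1 - \<epsilon>) * (dist x y + dist u v) \<le> dist x u + dist y v) \<and>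
      (\<forall>x\<in>N. \<forall>y\<in>N. \<forall>z\<in>N. \<forall>w\<in>N.
        (1 - \<epsilon>) * (dist x y + dist z w + 2 * dist u v)
          \<le> dist x u + dist y u + dist z v + dist w v)"
  proof (rule ccontr)
    assume no: "\<not> ?thesis"
    have bad: "\<exists>A C. decomposition_cost ?E (point_mass u - point_mass v) A C \<and>
        C \<le> (1 - \<epsilon> / 2) * (A + 2 * dist u v)" if uv: "u \<noteq> v" for u v
    proof -
      consider (pair) x y where "x \<in> N" "y \<in> N"
          "dist x u + dist y v < (1 - \<epsilon>) * (dist x y + dist u v)"
        | (quad) x y z w where "x \<in> N" "y \<in> N" "z \<in> N" "w \<in> N"
          "dist x u + dist y u + dist z v + dist w v
            < (1 - \<epsilon>) * (dist x y + dist z w + 2 * dist u v)"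
        using no uv unfolding not_le[symmetric] by blast
      then show ?thesis
      proof cases
        case pair
        from decomposition_cost_bad_pair[OF pair(1,2) ne less_imp_le[OF \<epsilon>(1)] pair(3)]
        show ?thesis by blast
      next
        case quad
        from decomposition_cost_bad_quadruple[OF quad(1-4) ne less_imp_le[OF \<epsilon>(1)] \<epsilon>(2) quad(5)]
        show ?thesis by blast
      qed
    qed
    \<comment> \<open>The final estimate needs \<open>8 * \<delta> < \<epsilon>\<close>: the errors total at most \<open>8 * \<delta>\<close>, the gain is at least
      \<open>\<epsilon>\<close>.\<close>
    define \<delta> where "\<delta> = \<epsilon> / 10"
    have \<delta>: "\<delta> > 0" using \<epsilon> by (simp add: \<delta>_def)
    have "finite ?E" using N\<^sub>0 by (intro finite_unit_molecules) (simp add: N_def)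
    from doh[unfolded decomposably_octahedral_def, rule_format, OF unit_molecules_sphere this \<delta>]
    obtain y where y: "norm y = 1"
      and oct: "\<And>(n::nat) ys xs a b. (\<Sum>i=1..n. ys i) = y \<Longrightarrow>
        (\<forall>i\<in>{1..n}. xs i \<in> ?E \<and> a i \<ge> 0 \<and> b i \<ge> 0) \<Longrightarrow>
        (1 - \<delta>) * ((\<Sum>i=1..n. a i + b i) + 2)
          \<le> (\<Sum>i=1..n. norm (a i *\<^sub>R xs i + ys i) + norm (b i *\<^sub>R xs i - ys i))"
      by auto
    obtain ts where ts: "norm (y - (\<Sum>(c, p, q)\<leftarrow>ts. c *\<^sub>R (point_mass p - point_mass q))) < \<delta>"
      "mol_cost ts < norm y + 2 * \<delta>"
      using lipfree_approx_cost[OF \<delta>] .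
    define z where "z = (\<Sum>(c, p, q)\<leftarrow>ts. c *\<^sub>R (point_mass p - point_mass q))"
    obtain A C where AC: "decomposition_cost ?E z A C" "C \<le> (1 - \<epsilon> / 2) * (A + 2 * mol_cost ts)"
      using decomposition_cost_sum_list[OF bad, of ts] unfolding z_def by blast
    \<comment> \<open>The approximation error becomes one more summand, with both coefficients zero.\<close>
    obtain e where "e \<in> ?E" using ne by blast
    from decomposition_cost_single[OF this order_refl order_refl, of "y - z"]
    have "decomposition_cost ?E (y - z) 0 (2 * norm (y - z))" by (simp add: norm_minus_commute)
    from decomposition_cost_add[OF AC(1) this]
    have "decomposition_cost ?E y A (C + 2 * norm (y - z))" by simp
    from decomposition_cost_sum[OF this]
    obtain n :: nat and ys xs a b where *: "(\<Sum>i=1..n. ys i) = y"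
      "\<forall>i\<in>{1..n}. xs i \<in> ?E \<and> a i \<ge> 0 \<and> b i \<ge> 0" "(\<Sum>i=1..n. a i + b i) = A"
      "(\<Sum>i=1..n. norm (a i *\<^sub>R xs i + ys i) + norm (b i *\<^sub>R xs i - ys i)) = C + 2 * norm (y - z)"
      by blast
    from oct[OF *(1,2)] have "(1 - \<delta>) * (A + 2) \<le> C + 2 * norm (y - z)"
      unfolding *(3,4) .
    also have "\<dots> \<le> (1 - \<epsilon> / 2) * (A + 2 * mol_cost ts) + 2 * \<delta>"
      using AC(2) ts(1) by (simp add: z_def)
    also have "\<dots> \<le> (1 - \<epsilon> / 2) * (A + 2 + 4 * \<delta>) + 2 * \<delta>"
      using ts(2) y \<epsilon> by (intro add_right_mono mult_left_mono) auto
    finally have "(1 - \<delta>) * (A + 2) \<le> (1 - \<epsilon> / 2) * (A + 2 + 4 * \<delta>) + 2 * \<delta>" .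
    moreover have "\<epsilon> * A \<ge> 0" using decomposition_cost_nonneg[OF AC(1)] \<epsilon> by simp
    moreover have "\<epsilon> * \<epsilon> > 0" using \<epsilon> by simp
    ultimately show False using \<epsilon>(1) unfolding \<delta>_def by (simp add: field_simps)
  qed
  then obtain u v where uv: "u \<noteq> v"
    and pair: "\<And>x y. x \<in> N \<Longrightarrow> y \<in> N \<Longrightarrow>
      (1 - \<epsilon>) * (dist x y + dist u v) \<le> dist x u + dist y v"
    and quad: "\<And>x y z w. x \<in> N \<Longrightarrow> y \<in> N \<Longrightarrow> z \<in> N \<Longrightarrow> w \<in> N \<Longrightarrow>
      (1 - \<epsilon>) * (dist x y + dist z w + 2 * dist u v) \<le> dist x u + dist y u + dist z v + dist w v"
    by auto
  have shrink: "(1 - \<epsilon>\<^sub>0) * r \<le> (1 - \<epsilon>) * r" if "r \<ge> 0" for r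
    using that \<epsilon>(3) by (intro mult_right_mono) auto
  have "(1 - \<epsilon>\<^sub>0) * (dist x y + dist u v) \<le> dist x u + dist y v" if "x \<in> N\<^sub>0" "y \<in> N\<^sub>0" for x y
    by (rule order_trans[OF shrink pair]) (use that in \<open>auto simp: N_def\<close>)
  moreover have "(1 - \<epsilon>\<^sub>0) * (dist x y + dist z w + 2 * dist u v)
      \<le> dist x u + dist y u + dist z v + dist w v"
    if "x \<in> N\<^sub>0" "y \<in> N\<^sub>0" "z \<in> N\<^sub>0" "w \<in> N\<^sub>0" for x y z w
    by (rule order_trans[OF shrink quad]) (use that in \<open>auto simp: N_def\<close>)
  ultimately show "\<exists>u\<in>UNIV. \<exists>v\<in>UNIV. u \<noteq> v \<and>
      (\<forall>x\<in>N\<^sub>0. \<forall>y\<in>N\<^sub>0. (1 - \<epsilon>\<^sub>0) * (dist x y + dist u v) \<le> dist x u + dist y v) \<and>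
      (\<forall>x\<in>N\<^sub>0. \<forall>y\<in>N\<^sub>0. \<forall>z\<in>N\<^sub>0. \<forall>w\<in>N\<^sub>0.
        (1 - \<epsilon>\<^sub>0) * (dist x y + dist z w + 2 * dist u v)
          \<le> dist x u + dist y u + dist z v + dist w v)"
    using uv by blast
qed

section \<open>The equivalence\<close>

theorem theorem2p2:
  assumes "\<exists>x y :: 'a::pointed_metric_space. x \<noteq> y"
  shows "(weak_star_SSD2P (lip0_functional :: 'a lip0 \<Rightarrow> ('a lipfree \<Rightarrow>\<^sub>L real))
            \<longleftrightarrow> decomposably_octahedral TYPE('a lipfree))
       \<and> (decomposably_octahedral TYPE('a lipfree)
            \<longleftrightarrow> strong_long_trapezoid (UNIV :: 'a set))"
  using weak_star_SSD2P_imp_decomposably_octahedral[OF linear_lip0_functional norm_lip0_functional]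
    decomposably_octahedral_imp_strong_long_trapezoid[OF _ assms]
    strong_long_trapezoid_imp_weak_star_SSD2P
  by blast

end
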